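(* Let $\Pi$ be a polar space of rank $n\ge3$ and let $k,l,m$ be natural numbers with $0<m\le k$, $l\le n$, $l-m=n-k>1$ and $m\le l-3$. If $f$ is an embedding of $PJ(l,m)$ in $\Gamma_k(\Pi)$ which maps every top of $PJ(l,m)$ to an independent subset of $\mathfrak G_k(\Pi)$ contained in a top of $\mathcal G_k(\Pi)$, then there exists a $(k-m-1)$-dimensional singular subspace $N$ such that the image of $f$ is an apartment in the parabolic subspace $[N\rangle_k$.
   Context: Polar space $\Pi$ of rank $n$: partial linear space with lines of $\ge3$ points, no point collinear with all others, each point collinear with one or all points of a line, finite flags of singular subspaces; maximal singular subspaces are $(n-1)$-dimensional projective spaces. $\mathcal G_j(\Pi)$: set of $j$-dimensional singular subspaces ($\dim\emptyset=-1$). For $j\le n-2$, $S,U\in\mathcal G_j(\Pi)$ are adjacent if $\dim(S\cap U)=j-1$ and every point of $S$ is collinear with every point of $U$; this gives $\Gamma_j(\Pi)$. $[S,U]_j=\{X\in\mathcal G_j(\Pi):S\subset X\subset U\}$, $\langle U]_j=\{X\in\mathcal G_j(\Pi):X\subset U\}$, $[S\rangle_j=\{X\in\mathcal G_j(\Pi):S\subset X\}$. The Grassmann space $\mathfrak G_k(\Pi)$ has points $\mathcal G_k(\Pi)$ and lines $[S,U]_k$, $S\in\mathcal G_{k-1}(\Pi)$, $U\in\mathcal G_{k+1}(\Pi)$, $S\subset U$. A top of $\mathcal G_k(\Pi)$ is $\langle U]_k$ with $U\in\mathcal G_{k+1}(\Pi)$. A subset $Z$ of a partial linear space is independent if the subspace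 it spans (smallest set containing $Z$ closed under lines through two collinear points) is not spanned by a proper subset. For a $(k-m-1)$-dimensional singular subspace $N$, $[N\rangle_{k-m}$ with lines $[S,U]_{k-m}$ ($N\subset S$) is a polar space of rank $n-k+m$; a frame of it is a set of $2(n-k+m)$ points each non-collinear with exactly one other point of the set; an apartment of the parabolic subspace $[N\rangle_k$ is, for such a frame $\mathcal B$, the set of all elements of $\mathcal G_k(\Pi)$ spanned (as subspaces of $\Pi$) by $m+1$ mutually collinear elements of $\mathcal B$. Polar Johnson graph $PJ(l,m)$: with $J=\{\pm1,\dots,\pm l\}$, singular subsets are those not containing both $j$ and $-j$; vertices are singular $(m+1)$-subsets, adjacent when they share $m$ elements and (if $m\le l-2$) their union is singular. A top of $PJ(l,m)$ is the set of all $(m+1)$-subsets of a singular $(m+2)$-subset of $J$. An embedding is an injective vertex map such that two vertices are adjacent iff their images are. *)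

theory Defs
  imports Main
begin

section \<open>Point-line geometries\<close>

text \<open>A geometry is given by its point set \<open>P\<close> and its set of lines \<open>L\<close>, each line being a set of
  points. The same notions are applied to a polar space, to its Grassmann spaces and to
  the geometries \<open>[N\<rangle>\<^sub>j\<close>, whose points are themselves sets.\<close>

definition collinear :: "'p set set \<Rightarrow> 'p \<Rightarrow> 'p \<Rightarrow> bool" where
  "collinear L p q \<longleftrightarrow> (\<exists>l\<in>L. p \<in> l \<and> q \<in> l)"

definition pls_subspace :: "'p set \<Rightarrow> 'p set set \<Rightarrow> 'p set \<Rightarrow> bool" where
  "pls_subspace P L S \<longleftrightarrow>
     S \<subseteq> P \<and> (\<forall>p\<in>S. \<forall>q\<in>S. p \<noteq> q \<longrightarrow> (\<forall>l\<in>L. p \<in> l \<and> q \<in> l \<longrightarrow> l \<subseteq> S))"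

definition pls_span :: "'p set \<Rightarrow> 'p set set \<Rightarrow> 'p set \<Rightarrow> 'p set" where
  "pls_span P L Z = \<Inter> {S. pls_subspace P L S \<and> Z \<subseteq> S}"

definition pls_independent :: "'p set \<Rightarrow> 'p set set \<Rightarrow> 'p set \<Rightarrow> bool" where
  "pls_independent P L Z \<longleftrightarrow> Z \<subseteq> P \<and> (\<forall>Y. Y \<subset> Z \<longrightarrow> pls_span P L Y \<noteq> pls_span P L Z)"

definition singular_subspace :: "'p set \<Rightarrow> 'p set set \<Rightarrow> 'p set \<Rightarrow> bool" where
  "singular_subspace P L S \<longleftrightarrow>
     pls_subspace P L S \<and> (\<forall>p\<in>S. \<forall>q\<in>S. p \<noteq> q \<longrightarrow> collinear L p q)"

definition maximal_singular_subspace :: "'p set \<Rightarrow> 'p set set \<Rightarrow> 'p set \<Rightarrow> bool" where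
  "maximal_singular_subspace P L M \<longleftrightarrow>
     singular_subspace P L M \<and> (\<forall>S. singular_subspace P L S \<and> M \<subseteq> S \<longrightarrow> S = M)"

text \<open>Dimension is one less than the cardinality of a base (independent spanning set); it is
  integer-valued because the empty subspace has dimension \<open>-1\<close>.\<close>

definition has_dim :: "'p set \<Rightarrow> 'p set set \<Rightarrow> 'p set \<Rightarrow> int \<Rightarrow> bool" where
  "has_dim P L S d \<longleftrightarrow>
     (\<exists>B. finite B \<and> pls_independent P L B \<and> pls_span P L B = S \<and> int (card B) = d + 1)"

locale partial_linear_space =
  fixes P :: "'p set" and L :: "'p set set"
  assumes line_subset: "l \<in> L \<Longrightarrow> l \<subseteq> P"
    and line_two_points: "l \<in> L \<Longrightarrow> \<exists>p\<in>l. \<exists>q\<in>l. p \<noteq> q"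
    and point_on_line: "p \<in> P \<Longrightarrow> \<exists>l\<in>L. p \<in> l"
    and line_unique: "\<lbrakk>l \<in> L; l' \<in> L; p \<in> l; q \<in> l; p \<in> l'; q \<in> l'; p \<noteq> q\<rbrakk> \<Longrightarrow> l = l'"

locale projective_space =
  fixes P :: "'p set" and L :: "'p set set"
  assumes line_subset: "l \<in> L \<Longrightarrow> l \<subseteq> P"
    and line_three_points: "l \<in> L \<Longrightarrow> \<exists>p\<in>l. \<exists>q\<in>l. \<exists>r\<in>l. p \<noteq> q \<and> p \<noteq> r \<and> q \<noteq> r"
    and unique_line: "\<lbrakk>p \<in> P; q \<in> P; p \<noteq> q\<rbrakk> \<Longrightarrow> \<exists>!l. l \<in> L \<and> p \<in> l \<and> q \<in> l"
    and veblen_young: "\<lbrakk>distinct [a, b, c, d]; l1 \<in> L; l2 \<in> L; m1 \<in> L; m2 \<in> L;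
          a \<in> l1; b \<in> l1; c \<in> l2; d \<in> l2; l1 \<inter> l2 \<noteq> {};
          a \<in> m1; c \<in> m1; b \<in> m2; d \<in> m2\<rbrakk> \<Longrightarrow> m1 \<inter> m2 \<noteq> {}"

section \<open>Polar spaces and their Grassmann spaces\<close>

locale polar_space = partial_linear_space P L
  for P :: "'p set" and L :: "'p set set" and n :: nat +
  assumes line_three_points: "l \<in> L \<Longrightarrow> \<exists>p\<in>l. \<exists>q\<in>l. \<exists>r\<in>l. p \<noteq> q \<and> p \<noteq> r \<and> q \<noteq> r"
    and nondegenerate: "p \<in> P \<Longrightarrow> \<exists>q\<in>P. q \<noteq> p \<and> \<not> collinear L p q"
    and one_or_all: "\<lbrakk>p \<in> P; l \<in> L\<rbrakk> \<Longrightarrow>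
          (\<exists>!q. q \<in> l \<and> collinear L p q) \<or> (\<forall>q\<in>l. collinear L p q)"
    and finite_flags: "\<lbrakk>F \<subseteq> {S. singular_subspace P L S}; chain\<^sub>\<subseteq> F\<rbrakk> \<Longrightarrow> finite F"
    and maximal_projective: "maximal_singular_subspace P L M \<Longrightarrow>
          projective_space M {l \<in> L. l \<subseteq> M}"
    and maximal_dim: "maximal_singular_subspace P L M \<Longrightarrow> has_dim P L M (int n - 1)"

definition Grass :: "'p set \<Rightarrow> 'p set set \<Rightarrow> int \<Rightarrow> 'p set set" where
  "Grass P L j = {S. singular_subspace P L S \<and> has_dim P L S j}"

text \<open>This is the adjacency for \<open>j \<le> n - 2\<close>; the graph on the maximal singular subspaces
  (\<open>j = n - 1\<close>) is defined differently and does not occur here.\<close>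

definition Grass_adj :: "'p set \<Rightarrow> 'p set set \<Rightarrow> int \<Rightarrow> 'p set \<Rightarrow> 'p set \<Rightarrow> bool" where
  "Grass_adj P L j S U \<longleftrightarrow>
     S \<in> Grass P L j \<and> U \<in> Grass P L j \<and> has_dim P L (S \<inter> U) (j - 1) \<and>
     (\<forall>p\<in>S. \<forall>q\<in>U. collinear L p q)"

text \<open>The sets \<open>[S,U]\<^sub>j\<close>, \<open>\<langle>U]\<^sub>j\<close> and \<open>[S\<rangle>\<^sub>j\<close>.\<close>

definition Grass_between ::
  "'p set \<Rightarrow> 'p set set \<Rightarrow> int \<Rightarrow> 'p set \<Rightarrow> 'p set \<Rightarrow> 'p set set" where
  "Grass_between P L j S U = {X \<in> Grass P L j. S \<subseteq> X \<and> X \<subseteq> U}"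

definition Grass_below :: "'p set \<Rightarrow> 'p set set \<Rightarrow> int \<Rightarrow> 'p set \<Rightarrow> 'p set set" where
  "Grass_below P L j U = {X \<in> Grass P L j. X \<subseteq> U}"

definition Grass_above :: "'p set \<Rightarrow> 'p set set \<Rightarrow> int \<Rightarrow> 'p set \<Rightarrow> 'p set set" where
  "Grass_above P L j S = {X \<in> Grass P L j. S \<subseteq> X}"

definition Grass_lines :: "'p set \<Rightarrow> 'p set set \<Rightarrow> int \<Rightarrow> 'p set set set" where
  "Grass_lines P L k =
     {Grass_between P L k S U | S U. S \<in> Grass P L (k - 1) \<and> U \<in> Grass P L (k + 1) \<and> S \<subseteq> U}"

definition Grass_tops :: "'p set \<Rightarrow> 'p set set \<Rightarrow> int \<Rightarrow> 'p set set set" where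
  "Grass_tops P L k = {Grass_below P L k U | U. U \<in> Grass P L (k + 1)}"

section \<open>Parabolic subspaces and apartments\<close>

text \<open>The lines of the polar space \<open>[N\<rangle>\<^sub>j\<close>. It is used with \<open>dim N = j - 1\<close>, so that \<open>N \<subseteq> S\<close>
  forces \<open>S = N\<close>; the inclusion must not be read as a strict one.\<close>

definition Grass_above_lines :: "'p set \<Rightarrow> 'p set set \<Rightarrow> int \<Rightarrow> 'p set \<Rightarrow> 'p set set set" where
  "Grass_above_lines P L j N =
     {Grass_between P L j S U | S U.
        S \<in> Grass P L (j - 1) \<and> U \<in> Grass P L (j + 1) \<and> S \<subseteq> U \<and> N \<subseteq> S}"

definition polar_frame :: "'p set \<Rightarrow> 'p set set \<Rightarrow> nat \<Rightarrow> 'p set \<Rightarrow> bool" where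
  "polar_frame P L r B \<longleftrightarrow>
     B \<subseteq> P \<and> finite B \<and> card B = 2 * r \<and>
     (\<forall>p\<in>B. \<exists>!q. q \<in> B \<and> q \<noteq> p \<and> \<not> collinear L p q)"

text \<open>Apartments of the parabolic subspace \<open>[N\<rangle>\<^sub>k\<close> of a rank \<open>n\<close> polar space, where
  \<open>dim N = k - m - 1\<close>. The elements of a frame are singular subspaces of the polar space, so
  those of a subset \<open>C\<close> of it together span the subspace generated by \<open>\<Union>C\<close>.\<close>

definition parabolic_apartment ::
  "'p set \<Rightarrow> 'p set set \<Rightarrow> nat \<Rightarrow> nat \<Rightarrow> nat \<Rightarrow> 'p set \<Rightarrow> 'p set set \<Rightarrow> bool" where
  "parabolic_apartment P L n k m N A \<longleftrightarrow>
     (\<exists>B. polar_frame (Grass_above P L (int k - int m) N)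
            (Grass_above_lines P L (int k - int m) N) (n - k + m) B \<and>
          A = {X \<in> Grass P L (int k). \<exists>C\<subseteq>B. card C = m + 1 \<and>
                 (\<forall>x\<in>C. \<forall>y\<in>C. collinear (Grass_above_lines P L (int k - int m) N) x y) \<and>
                 X = pls_span P L (\<Union>C)})"

section \<open>Polar Johnson graphs\<close>

definition PJ_ground :: "nat \<Rightarrow> int set" where
  "PJ_ground l = {j. j \<noteq> 0 \<and> \<bar>j\<bar> \<le> int l}"

definition PJ_singular :: "nat \<Rightarrow> int set \<Rightarrow> bool" where
  "PJ_singular l X \<longleftrightarrow> X \<subseteq> PJ_ground l \<and> (\<forall>j\<in>X. - j \<notin> X)"

definition PJ_vertices :: "nat \<Rightarrow> nat \<Rightarrow> int set set" where
  "PJ_vertices l m = {X. PJ_singular l X \<and> card X = m + 1}"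

definition PJ_adj :: "nat \<Rightarrow> nat \<Rightarrow> int set \<Rightarrow> int set \<Rightarrow> bool" where
  "PJ_adj l m X Y \<longleftrightarrow>
     X \<in> PJ_vertices l m \<and> Y \<in> PJ_vertices l m \<and> card (X \<inter> Y) = m \<and>
     (m + 2 \<le> l \<longrightarrow> PJ_singular l (X \<union> Y))"

definition PJ_tops :: "nat \<Rightarrow> nat \<Rightarrow> int set set set" where
  "PJ_tops l m = {{X. X \<subseteq> T \<and> card X = m + 1} | T. PJ_singular l T \<and> card T = m + 2}"

definition graph_embedding ::
  "'v set \<Rightarrow> ('v \<Rightarrow> 'v \<Rightarrow> bool) \<Rightarrow> 'w set \<Rightarrow> ('w \<Rightarrow> 'w \<Rightarrow> bool) \<Rightarrow> ('v \<Rightarrow> 'w) \<Rightarrow> bool" where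
  "graph_embedding V E W F f \<longleftrightarrow>
     f ` V \<subseteq> W \<and> inj_on f V \<and> (\<forall>x\<in>V. \<forall>y\<in>V. E x y \<longleftrightarrow> F (f x) (f y))"

end

theory Submission
  imports Defs
begin

text \<open>The image of the top given by a singular \<open>(m + 2)\<close>-set \<open>T\<close> consists of \<open>m + 2\<close>
  hyperplanes \<open>f (T - {t})\<close> of a \<open>(k + 1)\<close>-dimensional singular subspace; being independent in the
  dual projective space, they are the facets of a simplex over their common intersection, which has
  dimension \<open>k - m - 1\<close>. For a subset \<open>X\<close> of \<open>T\<close> with at most \<open>m\<close> elements, the face belonging
  to \<open>X\<close> does not depend on \<open>T\<close>: three pairwise adjacent vertices of \<open>PJ(l,m)\<close> with a common
  \<open>m\<close>-subset go to elements with a common \<open>(k - 1)\<close>-dimensional subspace, since otherwise one of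
  them would be adjacent to the image of a vertex at distance two, and any two \<open>T\<close> are joined by a
  chain of one-element exchanges (this uses \<open>m \<le> l - 3\<close>). The face of \<open>{}\<close> is the required \<open>N\<close>, and
  the faces of the one-element sets form the frame; opposite elements are non-collinear because \<open>f\<close>
  preserves non-adjacency.\<close>

section \<open>Singular subspaces\<close>

context polar_space
begin

abbreviation "subsp \<equiv> pls_subspace P L"
abbreviation "sing \<equiv> singular_subspace P L"
abbreviation "cl \<equiv> pls_span P L"

section \<open>Subspaces and their spans\<close>

lemma subsp_line:
  "\<lbrakk>subsp S; p \<in> S; q \<in> S; p \<noteq> q; l \<in> L; p \<in> l; q \<in> l\<rbrakk> \<Longrightarrow> l \<subseteq> S"
  unfolding pls_subspace_def by blast

lemma subsp_subset: "subsp S \<Longrightarrow> S \<subseteq> P"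
  unfolding pls_subspace_def by blast

lemma subsp_P: "subsp P"
  unfolding pls_subspace_def using line_subset by blast

lemma subsp_Inter:
  assumes "A \<noteq> {}" and "\<And>S. S \<in> A \<Longrightarrow> subsp S"
  shows "subsp (\<Inter>A)"
  unfolding pls_subspace_def
proof (intro conjI ballI impI)
  show "\<Inter>A \<subseteq> P" using assms subsp_subset by blast
  fix p q l assume "p \<in> \<Inter>A" "q \<in> \<Inter>A" "p \<noteq> q" "l \<in> L" "p \<in> l \<and> q \<in> l"
  then have "l \<subseteq> S" if "S \<in> A" for S using that subsp_line[OF assms(2), of S p q l] by blast
  then show "l \<subseteq> \<Inter>A" by blast
qed

lemma subsp_Int: "\<lbrakk>subsp S; subsp T\<rbrakk> \<Longrightarrow> subsp (S \<inter> T)"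
  using subsp_Inter[of "{S, T}"] by auto

lemma subsp_cl: "Z \<subseteq> P \<Longrightarrow> subsp (cl Z)"
  unfolding pls_span_def by (rule subsp_Inter) (use subsp_P in auto)

lemma cl_least: "\<lbrakk>subsp S; Z \<subseteq> S\<rbrakk> \<Longrightarrow> cl Z \<subseteq> S"
  unfolding pls_span_def by blast

lemma subset_cl: "Z \<subseteq> cl Z"
  unfolding pls_span_def by blast

lemma cl_mono: "Y \<subseteq> Z \<Longrightarrow> cl Y \<subseteq> cl Z"
  unfolding pls_span_def by blast

lemma cl_subsp: "subsp S \<Longrightarrow> cl S = S"
  using cl_least subset_cl by blast

lemma cl_insert_cl:
  assumes "insert x Z \<subseteq> P"
  shows "cl (insert x (cl Z)) = cl (insert x Z)"
proof
  have "cl Z \<subseteq> cl (insert x Z)" by (rule cl_mono) blast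
  then show "cl (insert x (cl Z)) \<subseteq> cl (insert x Z)"
    using subset_cl[of "insert x Z"] by (intro cl_least subsp_cl assms) auto
  show "cl (insert x Z) \<subseteq> cl (insert x (cl Z))"
    by (rule cl_mono) (use subset_cl[of Z] in blast)
qed

lemma subsp_point: "x \<in> P \<Longrightarrow> subsp {x}"
  unfolding pls_subspace_def by blast

lemma sing_subsp: "sing S \<Longrightarrow> subsp S"
  unfolding singular_subspace_def by blast

lemma sing_subset: "\<lbrakk>sing U; subsp S; S \<subseteq> U\<rbrakk> \<Longrightarrow> sing S"
  unfolding singular_subspace_def by blast

lemma collinear_refl: "p \<in> P \<Longrightarrow> collinear L p p"
  unfolding collinear_def using point_on_line by blast

lemma collinear_sym: "collinear L p q \<Longrightarrow> collinear L q p"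
  unfolding collinear_def by blast

lemma sing_collinear: "\<lbrakk>sing U; p \<in> U; q \<in> U\<rbrakk> \<Longrightarrow> collinear L p q"
  using collinear_refl[of p] subsp_subset[OF sing_subsp, of U] unfolding singular_subspace_def by (cases "p = q") blast+

lemma sing_lineE:
  assumes "sing U" "p \<in> U" "q \<in> U" "p \<noteq> q"
  obtains l where "l \<in> L" "p \<in> l" "q \<in> l" "l \<subseteq> U"
proof -
  obtain l where "l \<in> L" "p \<in> l" "q \<in> l"
    using assms unfolding singular_subspace_def collinear_def by blast
  then show thesis using that subsp_line[OF sing_subsp[OF assms(1)] assms(2-4)] by blast
qed

text \<open>Zorn's lemma applies because two points of the union of a chain already lie in one
  member of it. This carries the axioms on maximal singular subspaces over to all singular
  ones.\<close>

lemma sing_maximal: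
  assumes "sing S"
  obtains M where "maximal_singular_subspace P L M" "S \<subseteq> M"
proof -
  let ?A = "{T. sing T \<and> S \<subseteq> T}"
  have "\<exists>M\<in>?A. \<forall>X\<in>?A. M \<subseteq> X \<longrightarrow> X = M"
  proof (rule subset_Zorn_nonempty)
    show "?A \<noteq> {}" using assms by blast
    fix C assume C: "C \<noteq> {}" "subset.chain ?A C"
    have ch: "\<And>X Y. X \<in> C \<Longrightarrow> Y \<in> C \<Longrightarrow> X \<subseteq> Y \<or> Y \<subseteq> X"
      and sg: "\<And>X. X \<in> C \<Longrightarrow> sing X \<and> S \<subseteq> X"
      using C(2) unfolding subset_chain_def by blast+
    have two: "\<exists>X\<in>C. p \<in> X \<and> q \<in> X" if "p \<in> \<Union>C" "q \<in> \<Union>C" for p q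
      using that ch by blast
    have "subsp (\<Union>C)"
      unfolding pls_subspace_def
    proof (intro conjI ballI impI)
      show "\<Union>C \<subseteq> P" using sg sing_subsp subsp_subset by blast
      fix p q l assume "p \<in> \<Union>C" "q \<in> \<Union>C" and l: "p \<noteq> q" "l \<in> L" "p \<in> l \<and> q \<in> l"
      then obtain X where "X \<in> C" "p \<in> X" "q \<in> X" using two by blast
      then show "l \<subseteq> \<Union>C" using subsp_line[of X p q l] l sg sing_subsp by blast
    qed
    then have "sing (\<Union>C)"
      unfolding singular_subspace_def using two sg sing_collinear by metis
    then show "\<Union>C \<in> ?A" using C(1) sg by blast
  qed
  then obtain M where "sing M" "S \<subseteq> M" "\<And>X. sing X \<Longrightarrow> M \<subseteq> X \<Longrightarrow> X = M" by auto
  then show thesis using that[of M] unfolding maximal_singular_subspace_def by blast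
qed

section \<open>Joining a point to a singular subspace\<close>

text \<open>The Veblen-Young axiom of a maximal singular subspace above \<open>U\<close>, for two
  lines that cross \<open>l1\<close> and \<open>l2\<close> away from their common point
  \<open>o'\<close>. Unless the two share a crossing point, the four crossing points are distinct,
  as the axiom demands.\<close>

lemma coplanar_lines_meet:
  assumes U: "sing U" "l1 \<subseteq> U" "l2 \<subseteq> U" "m \<subseteq> U" "m' \<subseteq> U"
    and L: "l1 \<in> L" "l2 \<in> L" "m \<in> L" "m' \<in> L" "l1 \<noteq> l2"
    and o: "o' \<in> l1" "o' \<in> l2"
    and m: "a \<in> m" "a \<in> l1" "a \<noteq> o'" "b \<in> m" "b \<in> l2" "b \<noteq> o'"
    and m': "a' \<in> m'" "a' \<in> l1" "a' \<noteq> o'" "b' \<in> m'" "b' \<in> l2" "b' \<noteq> o'"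
  shows "m \<inter> m' \<noteq> {}"
proof (cases "a = a' \<or> b = b'")
  case True
  then show ?thesis using m m' by blast
next
  case False
  obtain M where M: "maximal_singular_subspace P L M" "U \<subseteq> M" using sing_maximal U(1) by blast
  interpret M: projective_space M "{l \<in> L. l \<subseteq> M}" using maximal_projective M(1) .
  have only: "\<And>x. x \<in> l1 \<Longrightarrow> x \<in> l2 \<Longrightarrow> x = o'" using line_unique L o by blast
  have "distinct [a, a', b, b']" using False only m m' by auto
  then show ?thesis
    using M.veblen_young[of a a' b b' l1 l2 m m'] U L o m m' M(2) by blast
qed

text \<open>Explicit form of the span of \<open>x\<close> and a nonempty subspace \<open>A\<close>
  off \<open>x\<close>, inside a singular subspace (\<open>cl_insert\<close>). For empty
  \<open>A\<close> it is empty, so it then misses \<open>x\<close>.\<close>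

definition point_join :: "'p \<Rightarrow> 'p set \<Rightarrow> 'p set" where
  "point_join x A = {r. \<exists>a\<in>A. \<exists>l\<in>L. a \<in> l \<and> x \<in> l \<and> r \<in> l}"

lemma point_join_mem:
  assumes U: "sing U" and A: "A \<subseteq> U" and x: "x \<in> U" "x \<notin> A" and a: "a \<in> A"
  shows "a \<in> point_join x A" "x \<in> point_join x A"
proof -
  have "a \<in> U" "a \<noteq> x" using assms by blast+
  then obtain l where "l \<in> L" "a \<in> l" "x \<in> l" using sing_lineE[OF U, of a x] x(1) by metis
  then show "a \<in> point_join x A" "x \<in> point_join x A" using a unfolding point_join_def by blast+
qed

text \<open>With \<open>p\<close> on the line \<open>la\<close> through \<open>x\<close>,
  \<open>a\<close> and \<open>q\<close> on the line \<open>lb\<close> through \<open>x\<close>,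
  \<open>b\<close>, the line \<open>k\<close> through \<open>p\<close>, \<open>q\<close> meets the
  line \<open>c\<close> through \<open>a\<close>, \<open>b\<close>: Veblen-Young with apex
  \<open>x\<close>. With apex \<open>p\<close> it then makes the line \<open>h\<close> through
  \<open>x\<close>, \<open>r\<close> meet \<open>c\<close>, and \<open>c\<close> lies in
  \<open>A\<close>.\<close>

lemma subsp_point_join:
  assumes U: "sing U" and A: "subsp A" "A \<subseteq> U" and x: "x \<in> U" "x \<notin> A"
  shows "subsp (point_join x A)"
proof -
  have lU: "l \<subseteq> U" if "l \<in> L" "a \<in> A" "a \<in> l" "x \<in> l" for l a
    using that subsp_line[OF sing_subsp[OF U], of a x l] A x by blast
  \<comment> \<open>Only one of the two points has to lie off \<open>A\<close>, and \<open>p\<close>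
    and \<open>q\<close> can be swapped later. That \<open>p\<close> is off \<open>A\<close> keeps
    it off the line \<open>c\<close>, so it can serve as the second apex.\<close>
  have key: "r \<in> point_join x A"
    if p: "p \<in> point_join x A" "p \<notin> A" and q: "q \<in> point_join x A" and "p \<noteq> q"
      and k: "k \<in> L" "p \<in> k" "q \<in> k" "r \<in> k" for p q r k
  proof -
    obtain a la where a: "a \<in> A" "la \<in> L" "a \<in> la" "x \<in> la" "p \<in> la"
      using p unfolding point_join_def by blast
    obtain b lb where b: "b \<in> A" "lb \<in> L" "b \<in> lb" "x \<in> lb" "q \<in> lb"
      using q unfolding point_join_def by blast
    have inla: "\<And>y. y \<in> la \<Longrightarrow> y \<in> point_join x A" and inlb: "\<And>y. y \<in> lb \<Longrightarrow> y \<in> point_join x A"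
      using a b unfolding point_join_def by blast+
    show ?thesis
    proof (cases "la = lb \<or> p = x \<or> q = x \<or> r = x \<or> r = p")
      case True
      have "k = la" if "q \<in> la" using that line_unique[OF k(1) a(2), of p q] k a \<open>p \<noteq> q\<close> by blast
      moreover have "k = lb" if "p \<in> lb"
        using that line_unique[OF k(1) b(2), of p q] k b \<open>p \<noteq> q\<close> by blast
      ultimately have "k = la \<or> k = lb \<or> r = x \<or> r = p" using True a(4) b(4,5) by blast
      then show ?thesis using inla inlb a(4) k(4) p(1) by blast
    next
      case False
      have lU': "la \<subseteq> U" "lb \<subseteq> U" using lU[of la a] lU[of lb b] a b by blast+
      have kU: "k \<subseteq> U"
        using subsp_line[OF sing_subsp[OF U] _ _ \<open>p \<noteq> q\<close> k(1-3)] lU' a(5) b(5) by blast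
      have ab: "a \<noteq> b" using False line_unique[OF a(2) b(2), of a x] a b x by blast
      have "a \<in> U" "b \<in> U" "r \<in> U" using a(1) b(1) A(2) kU k(4) by blast+
      obtain c where c: "c \<in> L" "a \<in> c" "b \<in> c"
        using sing_lineE[OF U \<open>a \<in> U\<close> \<open>b \<in> U\<close> ab] by metis
      have cA: "c \<subseteq> A" using subsp_line[OF A(1) a(1) b(1) ab c] .
      have "k \<inter> c \<noteq> {}"
        by (rule coplanar_lines_meet[OF U lU' kU, of c x p q a b])
          (use a b c k x cA A(2) False in auto)
      then obtain d where d: "d \<in> k" "d \<in> c" by blast
      obtain h where h: "h \<in> L" "x \<in> h" "r \<in> h" "h \<subseteq> U"
        using sing_lineE[OF U x(1) \<open>r \<in> U\<close>] False by metis
      have "la \<noteq> k" using False line_unique[OF a(2) b(2), of x q] a b k by blast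
      then have "h \<inter> c \<noteq> {}"
        by (intro coplanar_lines_meet[OF U lU'(1) kU, of h c p x r a d])
          (use a b c d k x h cA A(2) p(2) False in auto)
      then show ?thesis using h cA unfolding point_join_def by blast
    qed
  qed
  have AJ: "A \<subseteq> point_join x A" using point_join_mem[OF U A(2) x] by blast
  show ?thesis
    unfolding pls_subspace_def
  proof (intro conjI ballI impI)
    show "point_join x A \<subseteq> P" unfolding point_join_def using line_subset by blast
    fix p q l assume *: "p \<in> point_join x A" "q \<in> point_join x A" "p \<noteq> q" "l \<in> L" "p \<in> l \<and> q \<in> l"
    show "l \<subseteq> point_join x A"
    proof (cases "p \<in> A \<and> q \<in> A")
      case True
      then show ?thesis using * subsp_line[OF A(1), of p q l] AJ by blast
    next
      case False
      then show ?thesis using * key[of p q l] key[of q p l] by blast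
    qed
  qed
qed

lemma cl_insert:
  assumes U: "sing U" and A: "subsp A" "A \<subseteq> U" "A \<noteq> {}" and x: "x \<in> U" "x \<notin> A"
  shows "cl (insert x A) = point_join x A"
proof
  have xA: "insert x A \<subseteq> P" using A x subsp_subset sing_subsp U by blast
  have "insert x A \<subseteq> point_join x A" using point_join_mem[OF U A(2) x] A(3) by blast
  then show "cl (insert x A) \<subseteq> point_join x A"
    by (intro cl_least subsp_point_join[OF U A(1,2) x])
  show "point_join x A \<subseteq> cl (insert x A)"
  proof
    fix r assume "r \<in> point_join x A"
    then obtain a l where "a \<in> A" "l \<in> L" "a \<in> l" "x \<in> l" "r \<in> l" unfolding point_join_def by blast
    then show "r \<in> cl (insert x A)"
      using subsp_line[OF subsp_cl[OF xA], of a x l] subset_cl[of "insert x A"] x by blast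
  qed
qed

text \<open>Modular law. A point \<open>r \<noteq> x\<close> of \<open>W\<close> on a line from
  \<open>x\<close> to \<open>a \<in> A\<close> puts the whole line, hence \<open>a\<close>, into
  \<open>W\<close>.\<close>

lemma cl_insert_Int:
  assumes U: "sing U" and A: "subsp A" "A \<subseteq> U" and W: "subsp W" and x: "x \<in> U" "x \<in> W"
  shows "cl (insert x A) \<inter> W = cl (insert x (A \<inter> W))"
proof
  have WP: "insert x (A \<inter> W) \<subseteq> P" using W x subsp_subset by blast
  show "cl (insert x (A \<inter> W)) \<subseteq> cl (insert x A) \<inter> W"
    using x W cl_mono[of "insert x (A \<inter> W)" "insert x A"] cl_least[OF W, of "insert x (A \<inter> W)"] by auto
  show "cl (insert x A) \<inter> W \<subseteq> cl (insert x (A \<inter> W))"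
  proof
    fix r assume r: "r \<in> cl (insert x A) \<inter> W"
    consider "x \<in> A" | "A = {}" | "x \<notin> A" "A \<noteq> {}" by blast
    then show "r \<in> cl (insert x (A \<inter> W))"
    proof cases
      case 1
      then have "r \<in> A \<inter> W" using r cl_subsp[OF A(1)] by (simp add: insert_absorb)
      then show ?thesis using subset_cl[of "insert x (A \<inter> W)"] by blast
    next
      case 2
      then show ?thesis using r by simp
    next
      case 3
      then obtain a l where a: "a \<in> A" "l \<in> L" "a \<in> l" "x \<in> l" "r \<in> l"
        using r cl_insert[OF U A] x unfolding point_join_def by blast
      show ?thesis
      proof (cases "r = x")
        case True
        then show ?thesis using True subset_cl[of "insert x (A \<inter> W)"] by blast
      next
        case False
        then have "a \<in> W" using subsp_line[OF W, of r x l] r x a by blast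
        then have "a \<in> cl (insert x (A \<inter> W))" "x \<in> cl (insert x (A \<inter> W))" "a \<noteq> x"
          using a 3 subset_cl[of "insert x (A \<inter> W)"] by blast+
        then show ?thesis using subsp_line[OF subsp_cl[OF WP], of a x l] a by blast
      qed
    qed
  qed
qed

section \<open>Exchange, independence and bases\<close>

text \<open>By \<open>cl_insert\<close>, \<open>x\<close> lies on a line through \<open>y\<close>
  and some \<open>a\<close> in the span of \<open>Z\<close>; as \<open>x \<noteq> a\<close>, that
  line is determined by \<open>x\<close> and \<open>a\<close> as well.\<close>

lemma exchange:
  assumes U: "sing U" and Z: "insert x (insert y Z) \<subseteq> U"
    and x: "x \<in> cl (insert y Z)" "x \<notin> cl Z"
  shows "y \<in> cl (insert x Z)"
proof -
  have ZP: "Z \<subseteq> P" "insert x Z \<subseteq> P" "insert y Z \<subseteq> P" using Z U sing_subsp subsp_subset by blast+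
  have A: "subsp (cl Z)" "cl Z \<subseteq> U" using ZP Z U subsp_cl cl_least sing_subsp by auto
  have xA: "x \<in> cl (insert y (cl Z))" using x cl_insert_cl ZP by blast
  have yA: "y \<notin> cl Z" using xA x(2) cl_subsp[OF A(1)] by (metis insert_absorb)
  show ?thesis
  proof (cases "cl Z = {}")
    case True
    then have "x = y" using xA cl_subsp[OF subsp_point, of y] ZP by auto
    then show ?thesis using subset_cl[of "insert x Z"] by blast
  next
    case False
    then obtain a l where a: "a \<in> cl Z" "l \<in> L" "a \<in> l" "y \<in> l" "x \<in> l"
      using xA cl_insert[OF U A False, of y] yA Z unfolding point_join_def by blast
    have "a \<in> cl (insert x Z)" using a cl_mono[of Z "insert x Z"] by blast
    moreover have "x \<in> cl (insert x Z)" "a \<noteq> x" using subset_cl[of "insert x Z"] a x by blast+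
    ultimately show ?thesis using subsp_line[OF subsp_cl[OF ZP(2)], of a x l] a by blast
  qed
qed

lemma sing_cl:
  assumes "sing U" "Z \<subseteq> U"
  shows "sing (cl Z)" "subsp (cl Z)" "cl Z \<subseteq> U"
proof -
  show *: "cl Z \<subseteq> U" using assms by (intro cl_least sing_subsp)
  show "subsp (cl Z)" using assms subsp_subset[OF sing_subsp[of U]] by (intro subsp_cl) blast
  then show "sing (cl Z)" using sing_subset assms(1) * by blast
qed

lemma independent_iff:
  assumes "B \<subseteq> P"
  shows "pls_independent P L B \<longleftrightarrow> (\<forall>b\<in>B. b \<notin> cl (B - {b}))"
proof
  assume ind: "pls_independent P L B"
  show "\<forall>b\<in>B. b \<notin> cl (B - {b})"
  proof (intro ballI notI)
    fix b assume b: "b \<in> B" "b \<in> cl (B - {b})"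
    then have "B \<subseteq> cl (B - {b})" using subset_cl[of "B - {b}"] by blast
    then have "cl B \<subseteq> cl (B - {b})" using assms by (intro cl_least subsp_cl) auto
    then have "cl (B - {b}) = cl B" using cl_mono[of "B - {b}" B] by auto
    then show False using ind b(1) unfolding pls_independent_def by auto
  qed
next
  assume *: "\<forall>b\<in>B. b \<notin> cl (B - {b})"
  have "cl Y \<noteq> cl B" if Y: "Y \<subset> B" for Y
  proof -
    obtain b where b: "b \<in> B" "b \<notin> Y" using Y by blast
    then have "cl Y \<subseteq> cl (B - {b})" using Y by (intro cl_mono) blast
    then show ?thesis using b(1) * subset_cl[of B] by blast
  qed
  then show "pls_independent P L B" unfolding pls_independent_def using assms by blast
qed

lemma independent_insert:
  assumes U: "sing U" "insert c B \<subseteq> U" and B: "pls_independent P L B" and c: "c \<notin> cl B"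
  shows "pls_independent P L (insert c B)"
proof -
  have P: "insert c B \<subseteq> P" "B \<subseteq> P" using U sing_subsp subsp_subset by blast+
  have cB: "c \<notin> B" using c subset_cl[of B] by blast
  have "b \<notin> cl (insert c B - {b})" if "b \<in> insert c B" for b
  proof (cases "b = c")
    case True
    then show ?thesis using c cB by simp
  next
    case False
    then have b: "b \<in> B" using that by blast
    then have nb: "b \<notin> cl (B - {b})" using B independent_iff[OF P(2)] by blast
    have "insert c B - {b} = insert c (B - {b})" "insert b (B - {b}) = B" using False b by auto
    then show ?thesis using exchange[OF U(1), of b c "B - {b}"] U(2) nb c that by auto
  qed
  then show ?thesis using independent_iff[OF P(1)] by blast
qed

lemma independent_subset:
  assumes "pls_independent P L B" "A \<subseteq> B"
  shows "pls_independent P L A"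
proof -
  have B: "B \<subseteq> P" using assms(1) unfolding pls_independent_def by blast
  have "b \<notin> cl (A - {b})" if "b \<in> A" for b
    using that assms independent_iff[OF B] cl_mono[of "A - {b}" "B - {b}"] by blast
  then show ?thesis using independent_iff[of A] assms(2) B by blast
qed

text \<open>Induction on the number of elements of \<open>B\<close> outside \<open>C\<close>: one of
  them is replaced by an element of \<open>C\<close> not in the span of the others, which keeps
  \<open>B\<close> independent and of the same size.\<close>

lemma steinitz:
  assumes U: "sing U" "C \<subseteq> U" and C: "finite C"
    and B: "finite B" "pls_independent P L B" "B \<subseteq> cl C"
  shows "card B \<le> card C"
  using B
proof (induction "card (B - C)" arbitrary: B rule: less_induct)
  case less
  note B = less.prems
  have CU: "cl C \<subseteq> U" using U by (intro cl_least sing_subsp)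
  show ?case
  proof (cases "B \<subseteq> C")
    case True
    then show ?thesis using C card_mono by blast
  next
    case False
    then obtain b where b: "b \<in> B" "b \<notin> C" by blast
    have BP: "B \<subseteq> P" using B(2) unfolding pls_independent_def by blast
    have nb: "b \<notin> cl (B - {b})" using independent_iff[OF BP] B(2) b by blast
    have "\<not> C \<subseteq> cl (B - {b})"
    proof
      assume "C \<subseteq> cl (B - {b})"
      then have "cl C \<subseteq> cl (B - {b})" using BP by (intro cl_least subsp_cl) auto
      then show False using nb b B(3) by blast
    qed
    then obtain c where c: "c \<in> C" "c \<notin> cl (B - {b})" by blast
    let ?B = "insert c (B - {b})"
    have cB: "c \<notin> B - {b}" using c(2) subset_cl[of "B - {b}"] by blast
    have "?B \<subseteq> U" using c(1) B(3) CU U(2) by blast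
    then have "pls_independent P L ?B"
      by (rule independent_insert[OF U(1) _ independent_subset[OF B(2)] c(2)]) auto
    moreover have "?B \<subseteq> cl C" using B(3) c(1) subset_cl[of C] by blast
    moreover have "card (?B - C) < card (B - C)"
      using b c B(1) by (intro psubset_card_mono) auto
    ultimately have "card ?B \<le> card C" using less.hyps[of ?B] B(1) by blast
    moreover have "card ?B = card B"
      using card_insert_disjoint[OF _ cB] card_Suc_Diff1[OF B(1) b(1)] B(1) by simp
    ultimately show ?thesis by simp
  qed
qed

section \<open>Rank of a singular subspace\<close>

definition basis :: "'p set \<Rightarrow> 'p set \<Rightarrow> bool" where
  "basis S B \<longleftrightarrow> finite B \<and> pls_independent P L B \<and> cl B = S"

text \<open>Vector-space convention: one more than the projective dimension, so that the empty
  subspace has rank 0. The choice of basis is harmless on singular subspaces by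
  \<open>rk_basis\<close>.\<close>

definition rk :: "'p set \<Rightarrow> nat" where
  "rk S = card (SOME B. basis S B)"

lemma basis_subset: "basis S B \<Longrightarrow> B \<subseteq> S"
  unfolding basis_def using subset_cl[of B] by blast

text \<open>A largest independent subset of \<open>S\<close> spans it, and there is one because
  \<open>steinitz\<close> bounds the sizes by a finite basis of a maximal singular subspace above
  \<open>S\<close>.\<close>

lemma ex_basis:
  assumes S: "sing S"
  obtains B where "basis S B"
proof -
  obtain M where M: "maximal_singular_subspace P L M" "S \<subseteq> M" using sing_maximal[OF S] by blast
  have Ms: "sing M" using M(1) unfolding maximal_singular_subspace_def by blast
  obtain C where C: "basis M C" using maximal_dim[OF M(1)] unfolding has_dim_def basis_def by blast
  let ?Q = "\<lambda>B. finite B \<and> pls_independent P L B \<and> B \<subseteq> S"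
  have "card B \<le> card C" if "?Q B" for B
    using that C M(2) basis_subset[OF C] by (intro steinitz[OF Ms]) (auto simp: basis_def)
  moreover have "?Q {}" unfolding pls_independent_def by blast
  ultimately have "\<exists>B. ?Q B \<and> (\<forall>B'. ?Q B' \<longrightarrow> card B' \<le> card B)"
    by (intro ex_has_greatest_nat[of ?Q "{}" _ "Suc (card C)"]) (simp_all add: less_Suc_eq_le)
  then obtain B where B: "?Q B" "\<And>B'. ?Q B' \<Longrightarrow> card B' \<le> card B" by blast
  have "cl B \<subseteq> S" using B(1) S by (intro cl_least sing_subsp) auto
  moreover have "S \<subseteq> cl B"
  proof
    fix x assume x: "x \<in> S"
    show "x \<in> cl B"
    proof (rule ccontr)
      assume nx: "x \<notin> cl B"
      then have "?Q (insert x B)" using independent_insert[OF S, of x B] x B(1) by simp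
      moreover have "x \<notin> B" using nx subset_cl[of B] by blast
      ultimately show False using B(1) B(2)[of "insert x B"] by simp
    qed
  qed
  ultimately show thesis using that B(1) unfolding basis_def by blast
qed

lemma rk_basis:
  assumes "sing S" "basis S B"
  shows "rk S = card B"
proof -
  have C: "basis S (SOME C. basis S C)" by (rule someI[of _ B]) (rule assms(2))
  have "card A \<le> card B" if "basis S A" "basis S B" for A B
    using that basis_subset[of S A] basis_subset[of S B] unfolding basis_def
    by (intro steinitz[OF assms(1)]) auto
  then show ?thesis unfolding rk_def using C assms(2) by (metis antisym)
qed

lemma has_dim_iff:
  assumes "sing S"
  shows "has_dim P L S d \<longleftrightarrow> int (rk S) = d + 1"
proof
  show "has_dim P L S d \<Longrightarrow> int (rk S) = d + 1"
    using rk_basis[OF assms] unfolding has_dim_def basis_def by metis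
  obtain B where "basis S B" using ex_basis[OF assms] .
  then show "int (rk S) = d + 1 \<Longrightarrow> has_dim P L S d"
    using rk_basis[OF assms] unfolding has_dim_def basis_def by metis
qed

lemma Grass_iff: "S \<in> Grass P L d \<longleftrightarrow> sing S \<and> int (rk S) = d + 1"
  unfolding Grass_def using has_dim_iff by blast

lemma rk_mono:
  assumes "sing T" "subsp S" "S \<subseteq> T"
  shows "rk S \<le> rk T"
proof -
  have S: "sing S" using sing_subset assms by blast
  obtain A B where "basis S A" "basis T B" using ex_basis S assms(1) by metis
  then show ?thesis using assms rk_basis[OF S] rk_basis[OF assms(1)] basis_subset[of S A] basis_subset[of T B]
      steinitz[OF assms(1), of B A] unfolding basis_def by auto
qed

lemma rk_cl_insert:
  assumes U: "sing U" and S: "subsp S" "S \<subseteq> U" and x: "x \<in> U" "x \<notin> S"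
  shows "rk (cl (insert x S)) = Suc (rk S)"
proof -
  have Ss: "sing S" using sing_subset U S by blast
  obtain B where B: "basis S B" using ex_basis[OF Ss] .
  have xB: "insert x B \<subseteq> U" "x \<notin> B" using x S basis_subset[OF B] by auto
  have P: "insert x B \<subseteq> P" using xB(1) U sing_subsp subsp_subset by blast
  have "cl (insert x B) = cl (insert x S)" using cl_insert_cl[OF P] B unfolding basis_def by simp
  moreover have "pls_independent P L (insert x B)"
    using B x by (intro independent_insert[OF U xB(1)]) (auto simp: basis_def)
  ultimately have "basis (cl (insert x S)) (insert x B)" using B unfolding basis_def by simp
  moreover have "sing (cl (insert x S))" using S x by (intro sing_cl(1)[OF U]) blast
  ultimately have "rk (cl (insert x S)) = card (insert x B)" using rk_basis by blast
  then show ?thesis using rk_basis[OF Ss B] xB(2) B unfolding basis_def by simp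
qed

lemma rk_eqD:
  assumes T: "sing T" and S: "subsp S" "S \<subseteq> T" and "rk T \<le> rk S"
  shows "S = T"
proof (rule ccontr)
  assume "S \<noteq> T"
  then obtain x where x: "x \<in> T" "x \<notin> S" using S by blast
  have "insert x S \<subseteq> T" using x S by blast
  then have "rk (cl (insert x S)) \<le> rk T" by (intro rk_mono sing_cl(2,3)[OF T] T)
  then show False using rk_cl_insert[OF T S x] assms(4) by simp
qed

section \<open>Intersections with hyperplanes\<close>

text \<open>\<open>U\<close> is spanned by \<open>x\<close> and \<open>H\<close>, so the modular law
  \<open>cl_insert_Int\<close> computes \<open>W = W \<inter> U\<close>.\<close>

lemma hyperplane_cl_insert:
  assumes U: "sing U" and H: "subsp H" "H \<subseteq> U" "rk U = Suc (rk H)"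
    and W: "subsp W" "W \<subseteq> U" and x: "x \<in> W" "x \<notin> H"
  shows "W = cl (insert x (W \<inter> H))"
proof -
  have xU: "x \<in> U" "insert x H \<subseteq> U" using x W H by blast+
  have "cl (insert x H) = U"
    using rk_cl_insert[OF U H(1,2) xU(1) x(2)] H(3) by (intro rk_eqD[OF U sing_cl(2,3)[OF U xU(2)]]) simp
  then show ?thesis using cl_insert_Int[OF U H(1,2) W(1) xU(1) x(1)] W(2) by (simp add: Int_commute inf.absorb2)
qed

lemma rk_hyperplane_Int:
  assumes U: "sing U" and H: "subsp H" "H \<subseteq> U" "rk U = Suc (rk H)"
    and W: "subsp W" "W \<subseteq> U" "\<not> W \<subseteq> H"
  shows "rk W = Suc (rk (W \<inter> H))"
proof -
  obtain x where x: "x \<in> W" "x \<notin> H" using W by blast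
  have "rk (cl (insert x (W \<inter> H))) = Suc (rk (W \<inter> H))"
    using x W H by (intro rk_cl_insert[OF U] subsp_Int) auto
  then show ?thesis using hyperplane_cl_insert[OF U H W(1,2) x, symmetric] by simp
qed

lemma rk_Int_eq_hyperplanes:
  assumes U: "sing U" and H: "subsp H" "H \<subseteq> U" "rk U = Suc (rk H)"
    and K: "subsp K" "K \<subseteq> U" "rk U = Suc (rk K)" and "H \<noteq> K"
  shows "rk K = Suc (rk (K \<inter> H))"
proof (rule rk_hyperplane_Int[OF U H K(1,2)])
  have "rk H \<le> rk K" using H(3) K(3) by simp
  then show "\<not> K \<subseteq> H" using rk_eqD[OF sing_subset[OF U H(1,2)] K(1)] assms(8) by blast
qed

text \<open>By the one-or-all axiom the points collinear with every point of a set form a subspace.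
  Applied first to \<open>A\<close> and then to the span of \<open>B\<close>, this extends
  collinearity from the generators to both spans.\<close>

lemma cl_collinear:
  assumes "A \<subseteq> P" "B \<subseteq> P" "\<And>a b. a \<in> A \<Longrightarrow> b \<in> B \<Longrightarrow> collinear L a b"
    and "a \<in> cl A" "b \<in> cl B"
  shows "collinear L a b"
proof -
  have perp: "subsp {x \<in> P. \<forall>y\<in>Y. collinear L y x}" if "Y \<subseteq> P" for Y
    unfolding pls_subspace_def
  proof (intro conjI ballI impI)
    fix p q l
    assume pq: "p \<in> {x \<in> P. \<forall>y\<in>Y. collinear L y x}" "q \<in> {x \<in> P. \<forall>y\<in>Y. collinear L y x}"
      and l: "p \<noteq> q" "l \<in> L" "p \<in> l \<and> q \<in> l"
    have "\<forall>z\<in>l. collinear L y z" if y: "y \<in> Y" for y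
    proof -
      have "y \<in> P" "collinear L y p" "collinear L y q" using pq y \<open>Y \<subseteq> P\<close> by blast+
      then show ?thesis using one_or_all[of y l] l by blast
    qed
    then show "l \<subseteq> {x \<in> P. \<forall>y\<in>Y. collinear L y x}" using line_subset[OF l(2)] by blast
  qed blast
  have "B \<subseteq> {x \<in> P. \<forall>y\<in>A. collinear L y x}" using assms by blast
  then have clB: "cl B \<subseteq> {x \<in> P. \<forall>y\<in>A. collinear L y x}" using perp[OF assms(1)] cl_least by blast
  then have "A \<subseteq> {x \<in> P. \<forall>y\<in>cl B. collinear L y x}" using assms(1) collinear_sym by blast
  moreover have "subsp {x \<in> P. \<forall>y\<in>cl B. collinear L y x}" using clB by (intro perp) blast
  ultimately have "cl A \<subseteq> {x \<in> P. \<forall>y\<in>cl B. collinear L y x}" using cl_least by blast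
  then show ?thesis using assms(4,5) collinear_sym by blast
qed

end

section \<open>Hyperplanes and the dual space\<close>

context polar_space
begin

text \<open>The hyperplanes of \<open>U\<close> are the points of its dual, with lines \<open>[S,U]\<^sub>k\<close>. In the
  induction step for \<open>insert K F\<close>, \<open>H\<close> is on the line joining \<open>K\<close> to the hyperplane spanned by
  \<open>H \<inter> K\<close> and \<open>\<Inter>F\<close>.\<close>

lemma dual_span:
  assumes U: "sing U" "rk U = k + 2"
    and Z: "pls_subspace (Grass P L (int k)) (Grass_lines P L (int k)) Z"
    and F: "finite F" "F \<noteq> {}" "F \<subseteq> Z" "\<And>H. H \<in> F \<Longrightarrow> H \<subseteq> U"
    and H: "H \<in> Grass P L (int k)" "H \<subseteq> U" "\<Inter>F \<subseteq> H"
  shows "H \<in> Z"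
  using F H
proof (induction F arbitrary: H rule: finite_ne_induct)
  case (singleton K)
  then have "K \<in> Grass P L (int k)" using Z unfolding pls_subspace_def by blast
  then have "sing K" "rk K = rk H" "sing H" using singleton.prems unfolding Grass_iff by auto
  then have "K = H" using rk_eqD[of H K] singleton.prems sing_subsp by auto
  then show ?case using singleton.prems by blast
next
  case (insert K F)
  note H = insert.prems(3-5)
  have gr: "sing X \<and> subsp X \<and> rk X = k + 1" if "X \<in> Grass P L (int k)" for X
    using that sing_subsp unfolding Grass_iff by auto
  have ZG: "Z \<subseteq> Grass P L (int k)" using Z unfolding pls_subspace_def by blast
  have FZ: "F \<subseteq> Z" "\<And>X. X \<in> F \<Longrightarrow> X \<subseteq> U" and KZ: "K \<in> Z" "K \<subseteq> U" using insert.prems by blast+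
  have hK: "subsp K" "K \<subseteq> U" "rk U = Suc (rk K)" "K \<in> Grass P L (int k)"
    using gr KZ ZG U by auto
  have hH: "subsp H" "H \<subseteq> U" "rk U = Suc (rk H)" using gr H U by auto
  show ?case
  proof (cases "\<Inter>F \<subseteq> H \<or> H = K")
    case True
    then show ?thesis using insert.IH[OF FZ H(1,2)] KZ by blast
  next
    case False
    have W: "subsp (\<Inter>F)" "\<Inter>F \<subseteq> U"
      using FZ ZG gr insert.hyps(2) by (blast intro!: subsp_Inter, blast)
    obtain x where x: "x \<in> \<Inter>F" "x \<notin> K" using False H(3) by blast
    let ?S = "H \<inter> K" and ?K = "cl (insert x (H \<inter> K))"
    have S: "subsp ?S" "?S \<subseteq> U" "x \<notin> ?S" "x \<in> U" using hH hK subsp_Int x W by blast+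
    have "K \<noteq> H" using False by blast
    then have rS: "rk ?S = k" using rk_Int_eq_hyperplanes[OF U(1) hK(1-3) hH] hH(3) U(2) by simp
    have xS: "insert x ?S \<subseteq> U" using S by blast
    note K' = sing_cl(3,2)[OF U(1) xS]
    have "rk ?K = k + 1" using rk_cl_insert[OF U(1) S(1,2,4,3)] rS by simp
    then have KG: "?K \<in> Grass P L (int k)" using K' sing_subset[OF U(1)] unfolding Grass_iff by auto
    have "\<Inter>F \<inter> K \<subseteq> ?S" using H(3) by blast
    then have "\<Inter>F \<subseteq> ?K"
      using hyperplane_cl_insert[OF U(1) hK(1-3) W x] cl_mono[of "insert x (\<Inter>F \<inter> K)" "insert x ?S"] by blast
    then have KZ': "?K \<in> Z" using insert.IH[OF FZ KG K'(1)] by blast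
    have "?S \<in> Grass P L (int k - 1)" "U \<in> Grass P L (int k + 1)"
      using S rS U sing_subset[OF U(1)] unfolding Grass_iff by auto
    then have l: "Grass_between P L (int k) ?S U \<in> Grass_lines P L (int k)"
      using S(2) unfolding Grass_lines_def by blast
    have "?S \<subseteq> ?K" "x \<in> ?K" using subset_cl[of "insert x ?S"] by blast+
    then have "K \<noteq> ?K" "K \<in> Grass_between P L (int k) ?S U" "?K \<in> Grass_between P L (int k) ?S U"
      using KG K' hK(2,4) x(2) unfolding Grass_between_def by blast+
    then have "Grass_between P L (int k) ?S U \<subseteq> Z"
      using Z l KZ(1) KZ' unfolding pls_subspace_def by blast
    then show ?thesis using H unfolding Grass_between_def by blast
  qed
qed

text \<open>Otherwise \<open>dual_span\<close> would put \<open>K\<close> into every subspace of the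
  Grassmann space that contains the other members, and those would span as much as
  \<open>F\<close>.\<close>

lemma dual_independent:
  assumes U: "sing U" "rk U = k + 2" and F: "finite F" "\<And>H. H \<in> F \<Longrightarrow> H \<subseteq> U"
    and ind: "pls_independent (Grass P L (int k)) (Grass_lines P L (int k)) F"
    and K: "K \<in> F" "F - {K} \<noteq> {}"
  shows "\<not> \<Inter>(F - {K}) \<subseteq> K"
proof
  assume le: "\<Inter>(F - {K}) \<subseteq> K"
  let ?G = "Grass P L (int k)" and ?L = "Grass_lines P L (int k)"
  have FG: "F \<subseteq> ?G" using ind unfolding pls_independent_def by blast
  have "F \<subseteq> Z" if "pls_subspace ?G ?L Z" "F - {K} \<subseteq> Z" for Z
    using dual_span[OF U that(1) _ K(2) that(2) _ _ _ le] F FG K(1) that(2) by blast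
  then have "pls_span ?G ?L (F - {K}) = pls_span ?G ?L F"
    unfolding pls_span_def by blast
  moreover have "F - {K} \<subset> F" using K(1) by blast
  ultimately show False using ind unfolding pls_independent_def by blast
qed

end

section \<open>Faces of a simplex of hyperplanes\<close>

text \<open>The face on the vertices in \<open>X\<close> of the simplex whose facet opposite vertex
  \<open>i\<close> is \<open>H i\<close>. The intersection with \<open>U\<close> gives the right
  value \<open>U\<close> when \<open>X\<close> contains all of \<open>T\<close>.\<close>

definition dual_flat :: "'p set \<Rightarrow> 'i set \<Rightarrow> ('i \<Rightarrow> 'p set) \<Rightarrow> 'i set \<Rightarrow> 'p set" where
  "dual_flat U T H X = U \<inter> \<Inter>(H ` (T - X))"

lemma dual_flat_mono: "X \<subseteq> Y \<Longrightarrow> dual_flat U T H X \<subseteq> dual_flat U T H Y"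
  unfolding dual_flat_def by blast

lemma dual_flat_Int: "dual_flat U T H X \<inter> dual_flat U T H Y = dual_flat U T H (X \<inter> Y)"
  unfolding dual_flat_def by blast

text \<open>A simplex in the quotient of \<open>U\<close> by the common intersection of all
  \<open>H i\<close>, which turns out to have rank \<open>r\<close>.\<close>

locale hyperplane_frame = polar_space P L n
  for P :: "'p set" and L :: "'p set set" and n :: nat +
  fixes U :: "'p set" and T :: "'i set" and H :: "'i \<Rightarrow> 'p set" and r :: nat
  assumes sing_U: "sing U" and finite_T: "finite T" and rk_U: "rk U = card T + r"
    and hyperplane: "i \<in> T \<Longrightarrow> subsp (H i) \<and> H i \<subseteq> U \<and> rk U = Suc (rk (H i))"
    and irredundant: "i \<in> T \<Longrightarrow> \<not> dual_flat U T H {i} \<subseteq> H i"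
begin

lemma subsp_dual_flat: "subsp (dual_flat U T H X)"
proof -
  have "subsp (\<Inter>(insert U (H ` (T - X))))"
    by (rule subsp_Inter) (use sing_U sing_subsp hyperplane in auto)
  then show ?thesis unfolding dual_flat_def by simp
qed

lemma sing_dual_flat: "sing (dual_flat U T H X)"
  by (rule sing_subset[OF sing_U subsp_dual_flat]) (auto simp: dual_flat_def)

text \<open>Starting from \<open>U\<close>, cut by the hyperplanes outside \<open>X\<close> one at a
  time. Each cut costs exactly one rank: the intersection so far still contains the face of
  \<open>{i}\<close>, which is not inside \<open>H i\<close>.\<close>

lemma rk_dual_flat:
  assumes "X \<subseteq> T"
  shows "rk (dual_flat U T H X) = card X + r"
proof -
  have "rk (dual_flat U T H (T - A)) + card A = rk U" if "finite A" "A \<subseteq> T" for A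
    using that
  proof (induction A)
    case empty
    then show ?case unfolding dual_flat_def by simp
  next
    case (insert i A)
    let ?W = "dual_flat U T H (T - A)"
    have "dual_flat U T H {i} \<subseteq> ?W" using insert by (intro dual_flat_mono) blast
    then have "\<not> ?W \<subseteq> H i" using irredundant insert.prems by blast
    moreover have "?W \<subseteq> U" unfolding dual_flat_def by blast
    ultimately have "rk ?W = Suc (rk (?W \<inter> H i))"
      using hyperplane[of i] insert.prems subsp_dual_flat
      by (intro rk_hyperplane_Int[OF sing_U]) auto
    moreover have "?W \<inter> H i = dual_flat U T H (T - insert i A)"
      using insert unfolding dual_flat_def by blast
    ultimately show ?case using insert by simp
  qed
  from this[of "T - X"] have "rk (dual_flat U T H X) + card (T - X) = card T + r"
    using assms finite_T rk_U by (simp add: double_diff)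
  moreover have "card (T - X) + card X = card T"
    using card_Diff_subset[of X T] card_mono[OF finite_T assms] finite_subset[OF assms finite_T] assms
    by simp
  ultimately show ?thesis by simp
qed

text \<open>Induction on \<open>X\<close>: a point of the face of \<open>{j}\<close> outside the
  face of \<open>X\<close> adds one rank, so together with that face it already spans the face of
  \<open>insert j X\<close>.\<close>

lemma dual_flat_eq_cl:
  assumes "X \<subseteq> T" "X \<noteq> {}"
  shows "dual_flat U T H X = cl (\<Union>j\<in>X. dual_flat U T H {j})"
proof -
  have "finite X" using assms finite_T finite_subset by blast
  then show ?thesis using assms(2,1)
  proof (induction X rule: finite_ne_induct)
    case (singleton j)
    show ?case using cl_subsp subsp_dual_flat by simp
  next
    case (insert j X)
    let ?D = "dual_flat U T H" and ?K = "cl (\<Union>i\<in>insert j X. dual_flat U T H {i})"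
    \<comment> \<open>Faces meet in the face of the common indices, so an inclusion would collapse
      the face of \<open>{j}\<close> to that of \<open>{}\<close>, whose rank is one less.\<close>
    have "\<not> ?D {j} \<subseteq> ?D X"
    proof
      assume "?D {j} \<subseteq> ?D X"
      then have "?D {j} = ?D {}" using dual_flat_Int[of U T H "{j}" X] insert.hyps by auto
      then show False using rk_dual_flat[of "{j}"] rk_dual_flat[of "{}"] insert.prems by simp
    qed
    then obtain x where x: "x \<in> ?D {j}" "x \<notin> ?D X" by blast
    have le: "?D {i} \<subseteq> ?D (insert j X)" if "i \<in> insert j X" for i
      using that by (intro dual_flat_mono) blast
    have DX: "?D X \<subseteq> ?D (insert j X)" by (intro dual_flat_mono) blast
    have x': "x \<in> ?D (insert j X)" using x(1) le[of j] by blast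
    have P: "\<And>Y. ?D Y \<subseteq> P" using subsp_dual_flat subsp_subset by blast
    have "cl (insert x (?D X)) = ?D (insert j X)"
    proof (rule rk_eqD[OF sing_dual_flat])
      show "subsp (cl (insert x (?D X)))" using P[of X] P[of "{j}"] x by (intro subsp_cl) blast
      show "cl (insert x (?D X)) \<subseteq> ?D (insert j X)" using DX x' by (intro cl_least subsp_dual_flat) auto
      show "rk (?D (insert j X)) \<le> rk (cl (insert x (?D X)))"
        using rk_cl_insert[OF sing_dual_flat subsp_dual_flat DX x' x(2)] insert
          rk_dual_flat[of X] rk_dual_flat[of "insert j X"] by simp
    qed
    moreover have "cl (insert x (?D X)) \<subseteq> ?K"
    proof (rule cl_least)
      show "subsp ?K" using P by (intro subsp_cl) blast
      have "?D X \<subseteq> ?K" using insert.IH insert.prems cl_mono[of "\<Union>i\<in>X. ?D {i}" "\<Union>i\<in>insert j X. ?D {i}"] by auto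
      moreover have "x \<in> ?K" using x(1) subset_cl[of "\<Union>i\<in>insert j X. ?D {i}"] by blast
      ultimately show "insert x (?D X) \<subseteq> ?K" by blast
    qed
    moreover have "?K \<subseteq> ?D (insert j X)" using le by (intro cl_least subsp_dual_flat) blast
    ultimately show ?case by blast
  qed
qed

end

section \<open>Embeddings of polar Johnson graphs\<close>

lemma PJ_singular_subset: "\<lbrakk>PJ_singular l Y; X \<subseteq> Y\<rbrakk> \<Longrightarrow> PJ_singular l X"
  unfolding PJ_singular_def by blast

lemma PJ_ground_eq: "PJ_ground l = {- int l..- 1} \<union> {1..int l}"
  unfolding PJ_ground_def by auto

lemma finite_PJ_ground: "finite (PJ_ground l)"
  unfolding PJ_ground_eq by simp

lemma card_PJ_ground: "card (PJ_ground l) = 2 * l"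
  unfolding PJ_ground_eq by (subst card_Un_disjoint) auto

lemma PJ_ground_uminus: "- j \<in> PJ_ground l \<longleftrightarrow> j \<in> PJ_ground l"
  unfolding PJ_ground_def by simp

lemma PJ_singular_finite: "PJ_singular l X \<Longrightarrow> finite X"
  unfolding PJ_singular_def using finite_PJ_ground finite_subset by blast

lemma PJ_singular_insert:
  "PJ_singular l (insert s X) \<longleftrightarrow> s \<in> PJ_ground l \<and> - s \<notin> X \<and> PJ_singular l X"
proof -
  have "s \<in> PJ_ground l \<Longrightarrow> s \<noteq> - s" unfolding PJ_ground_def by auto
  moreover have "\<And>j. - j = s \<longleftrightarrow> j = - s" by auto
  ultimately show ?thesis unfolding PJ_singular_def by (auto simp: minus_equation_iff)
qed

text \<open>Absolute values are injective on a singular set, so fewer than \<open>l\<close> elements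
  leave one of \<open>1, ..., l\<close> free in both signs.\<close>

lemma PJ_singular_insertE:
  assumes X: "PJ_singular l X" "card X < l"
  obtains s where "s \<notin> X" "PJ_singular l (insert s X)"
proof -
  have inj: "inj_on abs X" using X(1) unfolding PJ_singular_def inj_on_def by (metis abs_eq_iff)
  have "card (abs ` X) < card {1..int l}" using card_image[OF inj] X(2) by simp
  moreover have "finite (abs ` X)" using PJ_singular_finite X(1) by blast
  ultimately have "\<not> {1..int l} \<subseteq> abs ` X" using card_mono[of "abs ` X" "{1..int l}"] by linarith
  then obtain s where s: "s \<in> {1..int l}" "s \<notin> abs ` X" by blast
  then have "s \<notin> X" "- s \<notin> X" "s \<in> PJ_ground l"
    unfolding PJ_ground_def by (force simp: image_iff)+
  then show thesis using that X(1) PJ_singular_insert by blast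
qed

lemma PJ_singular_extendE:
  assumes "PJ_singular l X" "card X \<le> e" "e \<le> l"
  obtains T where "X \<subseteq> T" "PJ_singular l T" "card T = e"
proof -
  have "\<exists>T. X \<subseteq> T \<and> PJ_singular l T \<and> card T = e" using assms(2,3)
  proof (induction e rule: dec_induct)
    case base
    then show ?case using assms(1) by blast
  next
    case (step e)
    then obtain T where T: "X \<subseteq> T" "PJ_singular l T" "card T = e" by auto
    then obtain s where "s \<notin> T" "PJ_singular l (insert s T)"
      using PJ_singular_insertE[of l T] step.prems by auto
    then show ?case using T PJ_singular_finite[OF T(2)] by (intro exI[of _ "insert s T"]) auto
  qed
  then show thesis using that by blast
qed

section \<open>The simplex carried by one top\<close>

locale johnson_embedding = polar_space P L n
  for P :: "'p set" and L :: "'p set set" and n :: nat +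
  fixes k l m :: nat and f :: "int set \<Rightarrow> 'p set"
  assumes m_pos: "0 < m" and m_le_k: "m \<le> k" and rank_sum: "l + k = n + m" and m_less_l: "m + 3 \<le> l"
    and embedding: "graph_embedding (PJ_vertices l m) (PJ_adj l m)
          (Grass P L (int k)) (Grass_adj P L (int k)) f"
    and tops_independent: "S \<in> PJ_tops l m \<Longrightarrow>
          pls_independent (Grass P L (int k)) (Grass_lines P L (int k)) (f ` S)"
    and tops_below: "S \<in> PJ_tops l m \<Longrightarrow> \<exists>U\<in>Grass_tops P L (int k). f ` S \<subseteq> U"
begin

abbreviation "singset \<equiv> PJ_singular l"

lemma f_Grass: "\<lbrakk>singset X; card X = m + 1\<rbrakk> \<Longrightarrow> f X \<in> Grass P L (int k)"
  using embedding unfolding graph_embedding_def PJ_vertices_def by blast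

lemma f_flat:
  assumes "singset X" "card X = m + 1"
  shows "sing (f X)" "subsp (f X)" "rk (f X) = k + 1"
  using f_Grass[OF assms] sing_subsp unfolding Grass_iff by auto

lemma f_inject: "\<lbrakk>singset X; card X = m + 1; singset Y; card Y = m + 1; f X = f Y\<rbrakk> \<Longrightarrow> X = Y"
  using embedding unfolding graph_embedding_def PJ_vertices_def inj_on_def by blast

text \<open>The direction of the embedding behind both contradictions below: images that are too
  close force their vertices to be adjacent.\<close>

lemma PJ_adj_if_collinear:
  assumes "singset X" "card X = m + 1" "singset Y" "card Y = m + 1"
    and "rk (f X \<inter> f Y) = k" "\<And>a b. a \<in> f X \<Longrightarrow> b \<in> f Y \<Longrightarrow> collinear L a b"
  shows "PJ_adj l m X Y"
proof -
  have "sing (f X \<inter> f Y)"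
    using sing_subset[OF f_flat(1)[OF assms(1,2)] subsp_Int[OF f_flat(2) f_flat(2)]] assms(1-4) by blast
  then have "Grass_adj P L (int k) (f X) (f Y)"
    unfolding Grass_adj_def using assms f_Grass has_dim_iff by auto
  then show ?thesis using embedding assms(1-4) unfolding graph_embedding_def PJ_vertices_def by blast
qed

text \<open>A \<open>(k + 1)\<close>-dimensional singular subspace above the image of the top of
  \<open>T\<close>, chosen by the property that the \<open>m + 2\<close> images form a simplex of
  hyperplanes in it; \<open>hyperplane_frame_ambient\<close> shows that one exists.\<close>

definition ambient :: "int set \<Rightarrow> 'p set" where
  "ambient T = (SOME U. hyperplane_frame P L n U T (\<lambda>i. f (T - {i})) (k - m))"

definition flat_in :: "int set \<Rightarrow> int set \<Rightarrow> 'p set" where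
  "flat_in T = dual_flat (ambient T) T (\<lambda>i. f (T - {i}))"

text \<open>Independence in the Grassmann space becomes irredundancy of the facets by
  \<open>dual_independent\<close>. The last parameter is the rank left after \<open>m + 2\<close>
  cuts of a subspace of rank \<open>k + 2\<close>.\<close>

lemma hyperplane_frame_ambient:
  assumes T: "singset T" "card T = m + 2"
  shows "hyperplane_frame P L n (ambient T) T (\<lambda>i. f (T - {i})) (k - m)"
proof -
  let ?S = "{X. X \<subseteq> T \<and> card X = m + 1}" and ?H = "\<lambda>i. f (T - {i})"
  have fin: "finite T" using T PJ_singular_finite by blast
  have S: "?S \<in> PJ_tops l m" using T unfolding PJ_tops_def by blast
  obtain U where U: "U \<in> Grass P L (int k + 1)" "f ` ?S \<subseteq> Grass_below P L (int k) U"
    using tops_below[OF S] unfolding Grass_tops_def by blast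
  have U': "sing U" "rk U = k + 2" using U(1) unfolding Grass_iff by auto
  have below: "f X \<subseteq> U" if "X \<in> ?S" for X using U(2) that unfolding Grass_below_def by blast
  have Ti: "T - {i} \<in> ?S" "singset (T - {i})" if "i \<in> T" for i
    using that T fin PJ_singular_subset[of l T "T - {i}"] by auto
  have "hyperplane_frame P L n U T ?H (k - m)"
  proof
    show "sing U" "finite T" using U' fin by blast+
    show "rk U = card T + (k - m)" using U' T m_le_k by simp
    fix i assume i: "i \<in> T"
    show "subsp (?H i) \<and> ?H i \<subseteq> U \<and> rk U = Suc (rk (?H i))"
      using f_flat[OF Ti(2)[OF i]] Ti(1)[OF i] below U' by auto
    \<comment> \<open>By injectivity of \<open>f\<close>, removing one facet from the image as a set
      loses only the index \<open>i\<close>, so the indexed family of the other facets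
      survives.\<close>
    have facets: "?H j \<in> f ` ?S - {?H i}" if j: "j \<in> T" "j \<noteq> i" for j
    proof -
      have "?H j \<noteq> ?H i" using f_inject[OF Ti(2) _ Ti(2), OF j(1) _ i] Ti(1)[OF i] Ti(1)[OF j(1)] i j by auto
      then show ?thesis using Ti(1)[OF j(1)] by simp
    qed
    have "\<not> T \<subseteq> {i}" using card_mono[of "{i}" T] T by auto
    then obtain j where j: "j \<in> T" "j \<noteq> i" by blast
    have ne: "f ` ?S - {?H i} \<noteq> {}"
      using facets[OF j] by (rule ex_in_conv[THEN iffD1, OF exI])
    have irr: "\<not> \<Inter>(f ` ?S - {?H i}) \<subseteq> ?H i"
    proof (rule dual_independent[OF U' _ _ tops_independent[OF S] _ ne])
      show "finite (f ` ?S)" using fin by simp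
      show "?H i \<in> f ` ?S" using Ti(1)[OF i] by (rule imageI)
    qed (use below in auto)
    have "\<Inter>(f ` ?S - {?H i}) \<subseteq> dual_flat U T ?H {i}"
    proof -
      have le: "\<Inter>(f ` ?S - {?H i}) \<subseteq> ?H j" if "j \<in> T" "j \<noteq> i" for j
        using facets[OF that] by (rule Inter_lower)
      have "?H j \<subseteq> U" using below Ti(1)[OF j(1)] by simp
      then have "\<Inter>(f ` ?S - {?H i}) \<subseteq> U" by (rule order_trans[OF le[OF j]])
      then show ?thesis unfolding dual_flat_def by (intro Int_greatest INF_greatest le) simp_all
    qed
    then show "\<not> dual_flat U T ?H {i} \<subseteq> ?H i" by (rule contrapos_nn[OF irr order_trans])
  qed
  then show ?thesis unfolding ambient_def by (rule someI)
qed

context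
  fixes T assumes T: "singset T" "card T = m + 2"
begin

interpretation frame: hyperplane_frame P L n "ambient T" T "\<lambda>i. f (T - {i})" "k - m"
  by (rule hyperplane_frame_ambient[OF T])

lemma sing_flat_in: "sing (flat_in T X)"
  unfolding flat_in_def by (rule frame.sing_dual_flat)

lemma rk_flat_in: "X \<subseteq> T \<Longrightarrow> rk (flat_in T X) = card X + (k - m)"
  unfolding flat_in_def by (rule frame.rk_dual_flat)

lemma flat_in_eq_cl: "\<lbrakk>X \<subseteq> T; X \<noteq> {}\<rbrakk> \<Longrightarrow> flat_in T X = cl (\<Union>j\<in>X. flat_in T {j})"
  unfolding flat_in_def by (rule frame.dual_flat_eq_cl)

lemma sing_ambient: "sing (ambient T)" "rk (ambient T) = k + 2"
  using frame.sing_U frame.rk_U T m_le_k by auto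

lemma f_subset_ambient: "t \<in> T \<Longrightarrow> f (T - {t}) \<subseteq> ambient T"
  using frame.hyperplane by blast

lemma flat_in_facet:
  assumes "T = insert t X" "t \<notin> X"
  shows "flat_in T X = f X"
proof -
  have "T - X = {t}" "T - {t} = X" "t \<in> T" using assms by blast+
  then show ?thesis
    using f_subset_ambient[of t] unfolding flat_in_def dual_flat_def by (simp add: inf.absorb2)
qed

text \<open>Isolates the dependence on the extra index \<open>s\<close>: each intersected pair is
  one that \<open>f_Int_f_exchange\<close> rewrites for another index.\<close>

lemma flat_in_eq_Inter:
  assumes Z: "T = insert s Z" "s \<notin> Z" and X: "X \<subset> Z"
  shows "flat_in T X = (\<Inter>z\<in>Z - X. f Z \<inter> f (insert s (Z - {z})))"
proof -
  have "T - X = insert s (Z - X)" "T - {s} = Z" using Z X by blast+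
  moreover have "T - {z} = insert s (Z - {z})" if "z \<in> Z - X" for z using that Z by blast
  then have "(\<lambda>i. f (T - {i})) ` (Z - X) = (\<lambda>z. f (insert s (Z - {z}))) ` (Z - X)"
    by (intro image_cong) auto
  ultimately have "flat_in T X = ambient T \<inter> (f Z \<inter> (\<Inter>z\<in>Z - X. f (insert s (Z - {z}))))"
    unfolding flat_in_def dual_flat_def by simp
  moreover have "f Z \<subseteq> ambient T" using f_subset_ambient[of s] \<open>T - {s} = Z\<close> Z(1) by simp
  moreover have "Z - X \<noteq> {}" using X by blast
  ultimately show ?thesis by blast
qed

end

lemma flat_in_mono: "X \<subseteq> Y \<Longrightarrow> flat_in T X \<subseteq> flat_in T Y"
  unfolding flat_in_def by (rule dual_flat_mono)

lemma flat_in_Int: "flat_in T X \<inter> flat_in T Y = flat_in T (X \<inter> Y)"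
  unfolding flat_in_def by (rule dual_flat_Int)

section \<open>Independence of the face from the top\<close>

lemma rk_f_Int_f:
  assumes Y: "card Y = m" "s \<notin> Y" "t \<notin> Y" "s \<noteq> t" and sg: "singset (insert s (insert t Y))"
  shows "rk (f (insert s Y) \<inter> f (insert t Y)) = k"
proof -
  let ?T = "insert s (insert t Y)"
  have fin: "finite Y" using Y(1) m_pos by (intro card_ge_0_finite) simp
  then have T: "singset ?T" "card ?T = m + 2" using Y sg by auto
  have "flat_in ?T (insert s Y) = f (insert s Y)" using Y by (intro flat_in_facet[OF T, of t]) auto
  moreover have "flat_in ?T (insert t Y) = f (insert t Y)" using Y by (intro flat_in_facet[OF T, of s]) auto
  moreover have "insert s Y \<inter> insert t Y = Y" using Y by blast
  ultimately have "f (insert s Y) \<inter> f (insert t Y) = flat_in ?T Y"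
    using flat_in_Int[of ?T "insert s Y" "insert t Y"] by simp
  then show ?thesis using rk_flat_in[OF T, of Y] Y(1) m_le_k by (simp add: subset_insertI2)
qed

text \<open>If the two intersections differ, \<open>f (insert s Y)\<close> is forced into the
  ambient subspace of \<open>insert t (insert u Y)\<close>. There it is one more hyperplane, hence
  adjacent to the image of a vertex that shares only \<open>m - 1\<close> indices with
  \<open>insert s Y\<close>.\<close>

lemma f_Int_f_triple:
  assumes Y: "card Y = m" "s \<notin> Y" "t \<notin> Y" "u \<notin> Y" and d: "s \<noteq> t" "s \<noteq> u" "t \<noteq> u"
    and sg: "singset (insert s (insert t (insert u Y)))"
  shows "f (insert s Y) \<inter> f (insert t Y) = f (insert s Y) \<inter> f (insert u Y)"
proof (rule ccontr)
  assume ne: "f (insert s Y) \<inter> f (insert t Y) \<noteq> f (insert s Y) \<inter> f (insert u Y)"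
  have fin: "finite Y" using Y(1) m_pos by (intro card_ge_0_finite) simp
  note sub = PJ_singular_subset[OF sg]
  let ?T = "insert t (insert u Y)"
  have T: "singset ?T" "card ?T = m + 2" using Y d fin sub[of ?T] by auto
  note U = sing_ambient[OF T]
  let ?A = "f (insert s Y)"
  have sY: "singset (insert s Y)" "card (insert s Y) = m + 1" using Y fin sub[of "insert s Y"] by auto
  note A = f_flat[OF sY]
  have tu: "f (insert t Y) \<subseteq> ambient ?T" "f (insert u Y) \<subseteq> ambient ?T"
  proof -
    have "?T - {u} = insert t Y" "?T - {t} = insert u Y" using Y d by auto
    then show "f (insert t Y) \<subseteq> ambient ?T" "f (insert u Y) \<subseteq> ambient ?T"
      using f_subset_ambient[OF T, of u] f_subset_ambient[OF T, of t] by auto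
  qed
  have r: "rk (?A \<inter> f (insert t Y)) = k" "rk (?A \<inter> f (insert u Y)) = k"
    by (rule rk_f_Int_f[OF Y(1,2,3) d(1)] rk_f_Int_f[OF Y(1,2,4) d(2)], rule sub, blast)+
  \<comment> \<open>Otherwise \<open>?A\<close> meets the ambient subspace in rank at most
    \<open>k\<close>; both intersections have rank \<open>k\<close> and lie in that meet, hence
    coincide.\<close>
  have AU: "?A \<subseteq> ambient ?T"
  proof (rule ccontr)
    assume n: "\<not> ?A \<subseteq> ambient ?T"
    let ?W = "?A \<inter> ambient ?T"
    have W: "subsp ?W" "sing ?W"
      using subsp_Int[OF A(2) sing_subsp[OF U(1)]] sing_subset[OF A(1)] by blast+
    have "\<not> rk ?A \<le> rk ?W" using rk_eqD[OF A(1) W(1)] n by blast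
    then have rW: "rk ?W \<le> k" using A(3) by simp
    have eq: "?A \<inter> f (insert v Y) = ?W"
      if v: "f (insert v Y) \<subseteq> ambient ?T" "rk (?A \<inter> f (insert v Y)) = k" "v \<in> {t, u}" for v
    proof (rule rk_eqD[OF W(2)])
      have "singset (insert v Y)" "card (insert v Y) = m + 1" using v(3) sub[of "insert v Y"] Y fin by auto
      then show "subsp (?A \<inter> f (insert v Y))" using subsp_Int A(2) f_flat(2) by blast
    qed (use v rW in auto)
    have "?A \<inter> f (insert t Y) = ?W" "?A \<inter> f (insert u Y) = ?W"
      using eq[of t] eq[of u] tu r by simp_all
    then show False using ne by blast
  qed
  \<comment> \<open>\<open>m > 0\<close> supplies an index \<open>x\<close> to drop from
    \<open>Y\<close>; the facet of \<open>?T\<close> opposite \<open>x\<close> is the image of a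
    vertex at distance two from \<open>insert s Y\<close>.\<close>
  obtain x where x: "x \<in> Y" using Y(1) m_pos by fastforce
  let ?Y = "insert t (insert u (Y - {x}))"
  have Yx: "Suc (card (Y - {x})) = m" using card_Suc_Diff1[OF fin x] Y(1) by simp
  then have Y': "singset ?Y" "card ?Y = m + 1" using Y d fin by (blast intro: sub, simp)
  have "?Y = ?T - {x}" using x Y by blast
  then have YU: "f ?Y \<subseteq> ambient ?T" using f_subset_ambient[OF T, of x] x by simp
  have "?A \<noteq> f ?Y" using f_inject[OF sY Y'] Y d by blast
  then have "rk (?A \<inter> f ?Y) = k"
    using rk_Int_eq_hyperplanes[OF U(1) f_flat(2)[OF Y'] YU _ A(2) AU] f_flat(3)[OF Y'] A(3) U(2) by auto
  then have "PJ_adj l m (insert s Y) ?Y"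
    using sing_collinear[OF U(1)] AU YU by (intro PJ_adj_if_collinear[OF sY Y']) blast+
  moreover have "insert s Y \<inter> ?Y = Y - {x}" using Y d by blast
  ultimately have "card (Y - {x}) = m" unfolding PJ_adj_def by simp
  then show False using Yx by simp
qed

text \<open>This is \<open>f_Int_f_triple\<close> for \<open>z\<close>, \<open>s\<close>,
  \<open>t\<close> over \<open>Z - {z}\<close>, unless \<open>t = - s\<close>.\<close>

lemma f_Int_f_exchange:
  assumes Z: "card Z = m + 1" "z \<in> Z" and s: "s \<notin> Z" "singset (insert s Z)"
    and t: "t \<notin> Z" "singset (insert t Z)"
  shows "f Z \<inter> f (insert s (Z - {z})) = f Z \<inter> f (insert t (Z - {z}))"
proof -
  have fin: "finite Z" using PJ_singular_finite[OF s(2)] by simp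
  have Zz: "insert z (Z - {z}) = Z" "card (Z - {z}) = m" using Z fin by auto
  have step: "f Z \<inter> f (insert a (Z - {z})) = f Z \<inter> f (insert b (Z - {z}))"
    if "a \<notin> Z" "b \<notin> Z" "a \<noteq> b" "singset (insert a (insert b Z))" for a b
  proof -
    have "insert z (insert a (insert b (Z - {z}))) = insert a (insert b Z)" using Z(2) by blast
    then have "singset (insert z (insert a (insert b (Z - {z}))))" using that(4) by simp
    moreover have "z \<notin> Z - {z}" "a \<notin> Z - {z}" "b \<notin> Z - {z}" "z \<noteq> a" "z \<noteq> b" using that Z(2) by blast+
    ultimately show ?thesis using f_Int_f_triple[OF Zz(2), of z a b] that(3) Zz(1) by metis
  qed
  show ?thesis
  proof (cases "t = - s")
    case False
    then show ?thesis using step[of s t] s t by (auto simp: PJ_singular_insert)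
  next
    case True
    \<comment> \<open>Opposite indices never share a singular set, so the exchange passes through a
      third index \<open>u\<close>, which exists because \<open>m + 2 < l\<close>.\<close>
    have "card (insert s Z) < l" using fin s(1) Z(1) m_less_l by simp
    then obtain u where u: "u \<notin> insert s Z" "singset (insert u (insert s Z))"
      using PJ_singular_insertE[OF s(2)] by blast
    then have "singset (insert u (insert t Z))" "u \<noteq> t"
      using t True by (auto simp: PJ_singular_insert)
    then show ?thesis using step[of u s] step[of u t] u s t by auto
  qed
qed

text \<open>Induction on the number of indices of \<open>T'\<close> missing from \<open>T\<close>,
  exchanging one index at a time.\<close>

lemma flat_in_eq:
  assumes "singset T" "card T = m + 2" and T': "singset T'" "card T' = m + 2"
    and X: "X \<subseteq> T \<inter> T'" "card X \<le> m"
  shows "flat_in T X = flat_in T' X"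
  using assms(1,2) X(1)
proof (induction "card (T' - T)" arbitrary: T rule: less_induct)
  case less
  note T = less.prems(1,2)
  have fin: "finite T" "finite T'" using T T' PJ_singular_finite by blast+
  show ?case
  proof (cases "T = T'")
    case False
    then have "\<not> T' \<subseteq> T" "\<not> T \<subseteq> T'"
      using card_subset_eq[OF fin(1), of T'] card_subset_eq[OF fin(2), of T] T T' by auto
    then obtain t' s where t': "t' \<in> T'" "t' \<notin> T" and s: "s \<in> T" "s \<notin> T'" by blast
    \<comment> \<open>To keep the exchanged set singular, \<open>- t'\<close> must leave if it is
      present. In both cases the leaving index is outside \<open>T'\<close>, so it is not in
      \<open>X\<close>.\<close>
    define t where "t = (if - t' \<in> T then - t' else s)"
    have "- t' \<notin> T'" using T'(1) t'(1) unfolding PJ_singular_def by blast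
    then have t: "t \<in> T" "t \<notin> T'" "- t' \<notin> T - {t}" using s unfolding t_def by auto
    let ?Z = "T - {t}"
    have Z: "card ?Z = m + 1" "insert t ?Z = T" "t \<notin> ?Z" "t' \<notin> ?Z" using t(1) t' T fin by auto
    have sg: "singset (insert t' ?Z)"
      using t(3) t'(1) T'(1) PJ_singular_subset[OF T(1), of ?Z]
      by (auto simp: PJ_singular_insert PJ_singular_def[of l T'])
    have cd: "card (insert t' ?Z) = m + 2" using Z fin by simp
    \<comment> \<open>The bound \<open>card X \<le> m\<close> makes the inclusion strict, as
      \<open>flat_in_eq_Inter\<close> requires.\<close>
    have XZ: "X \<subset> ?Z"
    proof
      show "X \<subseteq> ?Z" using less.prems(3) t(2) by blast
      show "X \<noteq> ?Z" using Z(1) X(2) by auto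
    qed
    have sgT: "singset (insert t ?Z)" using T(1) Z(2) by simp
    have "flat_in T X = flat_in (insert t' ?Z) X"
      using flat_in_eq_Inter[OF T Z(2)[symmetric] Z(3) XZ] flat_in_eq_Inter[OF sg cd refl Z(4) XZ]
        f_Int_f_exchange[OF Z(1) _ Z(3) sgT Z(4) sg] by simp
    moreover have "card (T' - insert t' ?Z) < card (T' - T)"
      using t t' fin by (intro psubset_card_mono) auto
    moreover have "X \<subseteq> insert t' ?Z \<inter> T'" using XZ less.prems(3) by blast
    ultimately show ?thesis using less.hyps[OF _ sg cd] by simp
  qed simp
qed

section \<open>Faces common to all tops\<close>

text \<open>By \<open>flat_in_eq\<close> the chosen \<open>T\<close> is immaterial when
  \<open>X\<close> has at most \<open>m\<close> elements and lies in some singular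
  \<open>(m + 2)\<close>-set.\<close>

definition frame_flat :: "int set \<Rightarrow> 'p set" where
  "frame_flat X = flat_in (SOME T. singset T \<and> card T = m + 2 \<and> X \<subseteq> T) X"

lemma flat_in_eq_frame_flat:
  assumes "singset T" "card T = m + 2" "X \<subseteq> T" "card X \<le> m"
  shows "flat_in T X = frame_flat X"
proof -
  let ?T = "SOME T. singset T \<and> card T = m + 2 \<and> X \<subseteq> T"
  have "singset ?T \<and> card ?T = m + 2 \<and> X \<subseteq> ?T" by (rule someI[of _ T]) (use assms in blast)
  then show ?thesis unfolding frame_flat_def using assms by (intro flat_in_eq) auto
qed

abbreviation vertex :: "'p set" where
  "vertex \<equiv> frame_flat {}"

abbreviation frame_pt :: "int \<Rightarrow> 'p set" where
  "frame_pt j \<equiv> frame_flat {j}"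

lemma frame_pt_eq: "\<lbrakk>singset T; card T = m + 2; j \<in> T\<rbrakk> \<Longrightarrow> frame_pt j = flat_in T {j}"
  using flat_in_eq_frame_flat[of T "{j}"] m_pos by simp

lemma vertex_eq: "\<lbrakk>singset T; card T = m + 2\<rbrakk> \<Longrightarrow> vertex = flat_in T {}"
  using flat_in_eq_frame_flat[of T "{}"] by simp

lemma pair_extendE:
  assumes "i \<in> PJ_ground l" "j \<in> PJ_ground l" "j \<noteq> - i" "2 \<le> e" "e \<le> l"
  obtains T where "singset T" "card T = e" "i \<in> T" "j \<in> T"
proof -
  have "singset {i, j}" using assms(1-3) by (auto simp: PJ_singular_insert PJ_singular_def[of l "{}"])
  moreover have "card {i, j} \<le> e" using assms(4) by (cases "i = j") auto
  ultimately obtain T where "{i, j} \<subseteq> T" "singset T" "card T = e"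
    using PJ_singular_extendE[OF _ _ assms(5)] by metis
  then show thesis using that by blast
qed

lemma ex_top:
  assumes Z: "singset Z" "card Z = m + 1"
  obtains s where "s \<notin> Z" "singset (insert s Z)" "card (insert s Z) = m + 2"
proof -
  obtain s where s: "s \<notin> Z" "singset (insert s Z)" using PJ_singular_insertE[OF Z(1)] Z m_less_l by auto
  then show thesis using that Z PJ_singular_finite[OF Z(1)] by simp
qed

text \<open>\<open>f Z\<close> is a facet of the simplex of any singular \<open>insert s Z\<close>,
  and a nonempty face is spanned by the faces of its single indices. This is the shape in which
  apartments are defined.\<close>

lemma f_eq_cl:
  assumes Z: "singset Z" "card Z = m + 1"
  shows "f Z = cl (\<Union>j\<in>Z. frame_pt j)"
proof -
  obtain s where s: "s \<notin> Z" and T: "singset (insert s Z)" "card (insert s Z) = m + 2" using ex_top[OF Z] .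
  let ?T = "insert s Z"
  have "f Z = flat_in ?T Z" using flat_in_facet[OF T refl s] by simp
  also have "\<dots> = cl (\<Union>j\<in>Z. flat_in ?T {j})" using Z(2) by (intro flat_in_eq_cl[OF T]) auto
  finally show ?thesis using frame_pt_eq[OF T] by simp
qed

lemma frame_flat_subset_f:
  assumes Z: "singset Z" "card Z = m + 1" and X: "X \<subseteq> Z" "card X \<le> m"
  shows "frame_flat X \<subseteq> f Z"
proof -
  obtain s where s: "s \<notin> Z" and T: "singset (insert s Z)" "card (insert s Z) = m + 2" using ex_top[OF Z] .
  have "flat_in (insert s Z) X = frame_flat X" using X by (intro flat_in_eq_frame_flat[OF T]) auto
  then show ?thesis using flat_in_mono[OF X(1)] flat_in_facet[OF T refl s] by metis
qed

lemma frame_flat_props: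
  assumes Z: "singset Z" "card Z = m + 1" and X: "X \<subseteq> Z" "card X \<le> m"
  shows "sing (frame_flat X)" "rk (frame_flat X) = card X + (k - m)"
proof -
  obtain s where s: "s \<notin> Z" and T: "singset (insert s Z)" "card (insert s Z) = m + 2" using ex_top[OF Z] .
  have "X \<subseteq> insert s Z" using X by blast
  then show "sing (frame_flat X)" "rk (frame_flat X) = card X + (k - m)"
    using flat_in_eq_frame_flat[OF T _ X(2)] sing_flat_in[OF T, of X] rk_flat_in[OF T, of X] by auto
qed

lemma frame_pt_subset_f: "\<lbrakk>singset Z; card Z = m + 1; j \<in> Z\<rbrakk> \<Longrightarrow> frame_pt j \<subseteq> f Z"
  using frame_flat_subset_f[of Z "{j}"] m_pos by simp

lemma vertex_Grass: "vertex \<in> Grass P L (int k - int m - 1)"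
proof -
  obtain T where T: "singset T" "card T = m + 2"
    using PJ_singular_extendE[of l "{}" "m + 2"] m_less_l unfolding PJ_singular_def by auto
  show ?thesis
    using sing_flat_in[OF T] rk_flat_in[OF T, of "{}"] m_le_k unfolding Grass_iff vertex_eq[OF T] by simp
qed

lemma frame_pt_Grass:
  assumes j: "j \<in> PJ_ground l"
  shows "frame_pt j \<in> Grass_above P L (int k - int m) vertex"
proof -
  have "j \<noteq> - j" using j unfolding PJ_ground_def by auto
  then obtain T where T: "singset T" "card T = m + 2" "j \<in> T"
    using pair_extendE[OF j j, of "m + 2"] m_less_l by auto
  show ?thesis
    using sing_flat_in[OF T(1,2)] rk_flat_in[OF T(1,2), of "{j}"] T(3) m_le_k flat_in_mono[of "{}" "{j}" T]
    unfolding Grass_above_def Grass_iff frame_pt_eq[OF T] vertex_eq[OF T(1,2)] by simp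
qed

section \<open>Collinearity of the frame elements\<close>

text \<open>Exchange \<open>i\<close> for \<open>- i\<close> in a vertex \<open>Z\<close> through
  \<open>i\<close>. A common \<open>U\<close> would make all generators of the two images collinear;
  the images share the face of \<open>Z - {i}\<close>, so the two vertices would be adjacent and
  their union singular, although it contains \<open>i\<close> and \<open>- i\<close>.\<close>

lemma opposite_not_singular:
  assumes i: "i \<in> PJ_ground l" and U: "sing U" "frame_pt i \<subseteq> U" "frame_pt (- i) \<subseteq> U"
  shows False
proof -
  have "i \<noteq> - i" using i unfolding PJ_ground_def by auto
  then obtain Z where Z: "singset Z" "card Z = m + 1" "i \<in> Z"
    using pair_extendE[OF i i, of "m + 1"] m_less_l m_pos by auto
  let ?Y = "Z - {i}" and ?Z = "insert (- i) (Z - {i})"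
  have fin: "finite Z" using Z PJ_singular_finite by blast
  have ni: "- i \<notin> Z" using Z unfolding PJ_singular_def by blast
  have Z': "singset ?Z" "card ?Z = m + 1"
    using PJ_singular_subset[OF Z(1), of ?Y] i ni Z fin by (auto simp: PJ_singular_insert PJ_ground_uminus)
  note fZ = f_flat[OF Z(1,2)] and fZ' = f_flat[OF Z']
  have pt: "collinear L a b" if xy: "x \<in> Z" "y \<in> ?Z" "a \<in> frame_pt x" "b \<in> frame_pt y" for a b x y
  proof -
    consider "x = i" "y = - i" | "x \<in> Z" "y \<in> Z" | "x \<in> ?Z" "y \<in> ?Z" using xy by blast
    then show ?thesis
    proof cases
      case 1
      then show ?thesis using sing_collinear[OF U(1)] U xy by blast
    next
      case 2
      then show ?thesis using sing_collinear[OF fZ(1)] frame_pt_subset_f[OF Z(1,2)] xy by blast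
    next
      case 3
      then show ?thesis using sing_collinear[OF fZ'(1)] frame_pt_subset_f[OF Z'] xy by blast
    qed
  qed
  have col: "collinear L a b" if "a \<in> f Z" "b \<in> f ?Z" for a b
  proof (rule cl_collinear)
    show "a \<in> cl (\<Union>j\<in>Z. frame_pt j)" "b \<in> cl (\<Union>j\<in>?Z. frame_pt j)"
      using that f_eq_cl[OF Z(1,2)] f_eq_cl[OF Z'] by auto
    show "(\<Union>j\<in>Z. frame_pt j) \<subseteq> P" "(\<Union>j\<in>?Z. frame_pt j) \<subseteq> P"
      using frame_pt_subset_f[OF Z(1,2)] frame_pt_subset_f[OF Z'] subsp_subset[OF fZ(2)] subsp_subset[OF fZ'(2)]
      by blast+
  qed (use pt in blast)
  \<comment> \<open>At most \<open>k\<close> because the images are distinct; at least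
    \<open>k\<close> because of the common face of \<open>?Y\<close>, of rank
    \<open>m + (k - m)\<close>.\<close>
  have "rk (f Z \<inter> f ?Z) = k"
  proof (rule antisym)
    have W: "subsp (f Z \<inter> f ?Z)" using subsp_Int fZ(2) fZ'(2) by blast
    show "rk (f Z \<inter> f ?Z) \<le> k"
    proof (rule ccontr)
      assume "\<not> rk (f Z \<inter> f ?Z) \<le> k"
      then have "f Z \<inter> f ?Z = f Z" "f Z \<inter> f ?Z = f ?Z"
        using rk_eqD[OF fZ(1) W] rk_eqD[OF fZ'(1) W] fZ(3) fZ'(3) by auto
      then have "Z = ?Z" using f_inject[OF Z(1,2) Z'] by blast
      then show False using ni by blast
    qed
    have Y: "?Y \<subseteq> Z" "?Y \<subseteq> ?Z" "card ?Y = m" using Z fin by auto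
    have "frame_flat ?Y \<subseteq> f Z \<inter> f ?Z"
      using frame_flat_subset_f[OF Z(1,2) Y(1)] frame_flat_subset_f[OF Z' Y(2)] Y(3) by simp
    moreover have "sing (f Z \<inter> f ?Z)" using sing_subset[OF fZ(1) W] by blast
    ultimately have "rk (frame_flat ?Y) \<le> rk (f Z \<inter> f ?Z)"
      using frame_flat_props[OF Z(1,2) Y(1)] Y(3) sing_subsp by (intro rk_mono) auto
    then show "k \<le> rk (f Z \<inter> f ?Z)" using frame_flat_props[OF Z(1,2) Y(1)] Y(3) m_le_k by simp
  qed
  then have "PJ_adj l m Z ?Z" using col by (intro PJ_adj_if_collinear Z(1,2) Z') auto
  then have "singset (Z \<union> ?Z)" unfolding PJ_adj_def using m_less_l by simp
  then show False using Z(3) unfolding PJ_singular_def by blast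
qed

abbreviation "residue \<equiv> Grass_above P L (int k - int m) vertex"
abbreviation "residue_lines \<equiv> Grass_above_lines P L (int k - int m) vertex"

text \<open>The elements of a residue line lie in one singular subspace, which excludes opposite
  indices; any other pair lies in a common \<open>T\<close>, where a two-element face gives the
  line.\<close>

lemma residue_collinear_iff:
  assumes i: "i \<in> PJ_ground l" and j: "j \<in> PJ_ground l"
  shows "collinear residue_lines (frame_pt i) (frame_pt j) \<longleftrightarrow> j \<noteq> - i"
proof
  assume "collinear residue_lines (frame_pt i) (frame_pt j)"
  then obtain U where "sing U" "frame_pt i \<subseteq> U" "frame_pt j \<subseteq> U"
    unfolding collinear_def Grass_above_lines_def Grass_between_def Grass_iff by blast
  then show "j \<noteq> - i" using opposite_not_singular[OF i] by blast
next
  assume "j \<noteq> - i"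
  then obtain T where T: "singset T" "card T = m + 2" "i \<in> T" "j \<in> T"
    using pair_extendE[OF i j, of "m + 2"] m_less_l by auto
  \<comment> \<open>Even for \<open>i = j\<close> the face needs two indices: the upper end of a
    line has dimension one more than the frame elements.\<close>
  obtain X where X: "X \<subseteq> T" "card X = 2" "i \<in> X" "j \<in> X"
  proof (cases "i = j")
    case True
    have "\<not> T \<subseteq> {i}" using card_mono[of "{i}" T] T(2) by auto
    then obtain h where "h \<in> T" "h \<noteq> i" by blast
    then show thesis using that[of "{i, h}"] T True by auto
  next
    case False
    then show thesis using that[of "{i, j}"] T by auto
  qed
  \<comment> \<open>The face is taken inside \<open>T\<close> because two indices may exceed the
    bound \<open>m\<close> up to which \<open>frame_flat\<close> is controlled.\<close>
  let ?U = "flat_in T X"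
  have "frame_pt i \<subseteq> ?U" "frame_pt j \<subseteq> ?U" "vertex \<subseteq> ?U"
    using flat_in_mono[of "{i}" X T] flat_in_mono[of "{j}" X T] flat_in_mono[of "{}" X T] X
      frame_pt_eq[OF T(1,2,3)] frame_pt_eq[OF T(1,2,4)] vertex_eq[OF T(1,2)] by auto
  moreover have "?U \<in> Grass P L (int k - int m + 1)"
    using sing_flat_in[OF T(1,2)] rk_flat_in[OF T(1,2) X(1)] X(2) m_le_k unfolding Grass_iff by simp
  ultimately have "Grass_between P L (int k - int m) vertex ?U \<in> residue_lines"
      and "frame_pt i \<in> Grass_between P L (int k - int m) vertex ?U"
      and "frame_pt j \<in> Grass_between P L (int k - int m) vertex ?U"
    using frame_pt_Grass[OF i] frame_pt_Grass[OF j] vertex_Grass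
    unfolding Grass_above_lines_def Grass_between_def Grass_above_def by auto
  then show "collinear residue_lines (frame_pt i) (frame_pt j)" unfolding collinear_def by blast
qed

text \<open>Equal elements are collinear, so the indices are not opposite and lie in one
  \<open>T\<close>; there both faces would equal their meet \<open>vertex\<close>, which has smaller
  rank.\<close>

lemma inj_on_frame_pt: "inj_on frame_pt (PJ_ground l)"
proof (rule inj_onI, rule ccontr)
  fix i j assume i: "i \<in> PJ_ground l" and j: "j \<in> PJ_ground l" and eq: "frame_pt i = frame_pt j" and "i \<noteq> j"
  have "i \<noteq> - i" using i unfolding PJ_ground_def by auto
  then have "collinear residue_lines (frame_pt i) (frame_pt j)"
    using residue_collinear_iff[OF i i] eq by simp
  then have "j \<noteq> - i" using residue_collinear_iff[OF i j] by blast
  then obtain T where T: "singset T" "card T = m + 2" "i \<in> T" "j \<in> T"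
    using pair_extendE[OF i j, of "m + 2"] m_less_l by auto
  have "flat_in T {i} = flat_in T {j}"
    using eq frame_pt_eq[OF T(1,2,3)] frame_pt_eq[OF T(1,2,4)] by simp
  then have "flat_in T {i} = flat_in T {}" using flat_in_Int[of T "{i}" "{j}"] \<open>i \<noteq> j\<close> by simp
  then show False using rk_flat_in[OF T(1,2), of "{i}"] rk_flat_in[OF T(1,2), of "{}"] T(3) by simp
qed

section \<open>The frame and its apartment\<close>

lemma polar_frame_frame_pts: "polar_frame residue residue_lines l (frame_pt ` PJ_ground l)"
  unfolding polar_frame_def
proof (intro conjI ballI)
  show "frame_pt ` PJ_ground l \<subseteq> residue" using frame_pt_Grass by blast
  show "finite (frame_pt ` PJ_ground l)" using finite_PJ_ground by simp
  show "card (frame_pt ` PJ_ground l) = 2 * l" using card_image[OF inj_on_frame_pt] card_PJ_ground by simp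
  fix p assume "p \<in> frame_pt ` PJ_ground l"
  then obtain i where i: "i \<in> PJ_ground l" "p = frame_pt i" by blast
  have ni: "- i \<in> PJ_ground l" "- i \<noteq> i" using i(1) unfolding PJ_ground_def by auto
  show "\<exists>!q. q \<in> frame_pt ` PJ_ground l \<and> q \<noteq> p \<and> \<not> collinear residue_lines p q"
  proof (rule ex1I[of _ "frame_pt (- i)"])
    show "frame_pt (- i) \<in> frame_pt ` PJ_ground l \<and> frame_pt (- i) \<noteq> p
        \<and> \<not> collinear residue_lines p (frame_pt (- i))"
      using residue_collinear_iff[OF i(1) ni(1)] inj_onD[OF inj_on_frame_pt _ ni(1) i(1)] i(2) ni by blast
    fix q assume "q \<in> frame_pt ` PJ_ground l \<and> q \<noteq> p \<and> \<not> collinear residue_lines p q"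
    then show "q = frame_pt (- i)" using residue_collinear_iff[OF i(1)] i(2) by blast
  qed
qed

text \<open>Taking \<open>frame_pt\<close> turns singular index sets into collinear subsets of the
  frame and back, and by \<open>f_eq_cl\<close> the image of a vertex is the span of its
  subset.\<close>

lemma image_is_apartment: "parabolic_apartment P L n k m vertex (f ` PJ_vertices l m)"
  unfolding parabolic_apartment_def
proof (intro exI conjI)
  \<comment> \<open>\<open>rank_sum\<close> and \<open>m + 3 \<le> l\<close> give
    \<open>k \<le> n\<close>, so the truncated subtraction is exact.\<close>
  have "n - k + m = l" using rank_sum m_less_l by simp
  then show "polar_frame residue residue_lines (n - k + m) (frame_pt ` PJ_ground l)"
    using polar_frame_frame_pts by simp
  let ?A = "{X \<in> Grass P L (int k). \<exists>C\<subseteq>frame_pt ` PJ_ground l. card C = m + 1 \<and>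
        (\<forall>x\<in>C. \<forall>y\<in>C. collinear residue_lines x y) \<and> X = cl (\<Union>C)}"
  show "f ` PJ_vertices l m = ?A"
  proof (intro equalityI subsetI)
    fix A assume "A \<in> f ` PJ_vertices l m"
    then obtain Z where Z: "singset Z" "card Z = m + 1" "A = f Z" unfolding PJ_vertices_def by blast
    have ZJ: "Z \<subseteq> PJ_ground l" and opp: "\<And>i j. i \<in> Z \<Longrightarrow> j \<in> Z \<Longrightarrow> j \<noteq> - i"
      using Z(1) unfolding PJ_singular_def by blast+
    have "frame_pt ` Z \<subseteq> frame_pt ` PJ_ground l" using ZJ by blast
    moreover have "card (frame_pt ` Z) = m + 1"
      using card_image[OF inj_on_subset[OF inj_on_frame_pt ZJ]] Z(2) by simp
    moreover have "\<forall>x\<in>frame_pt ` Z. \<forall>y\<in>frame_pt ` Z. collinear residue_lines x y"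
      using residue_collinear_iff opp ZJ by (simp add: subset_iff)
    ultimately show "A \<in> ?A" using f_Grass[OF Z(1,2)] f_eq_cl[OF Z(1,2)] Z(3) by blast
  next
    fix A assume "A \<in> ?A"
    then obtain C where C: "C \<subseteq> frame_pt ` PJ_ground l" "card C = m + 1" "A = cl (\<Union>C)"
      and col: "\<And>x y. x \<in> C \<Longrightarrow> y \<in> C \<Longrightarrow> collinear residue_lines x y" by blast
    obtain Z where Z: "Z \<subseteq> PJ_ground l" "C = frame_pt ` Z" using C(1) unfolding subset_image_iff by blast
    have "- i \<notin> Z" if "i \<in> Z" for i
      using col[of "frame_pt i" "frame_pt (- i)"] residue_collinear_iff[of i "- i"] Z that by blast
    then have sZ: "singset Z" using Z(1) unfolding PJ_singular_def by blast
    have cZ: "card Z = m + 1" using card_image[OF inj_on_subset[OF inj_on_frame_pt Z(1)]] Z(2) C(2) by simp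
    have "A = f Z" using f_eq_cl[OF sZ cZ] C(3) Z(2) by simp
    then show "A \<in> f ` PJ_vertices l m" using sZ cZ unfolding PJ_vertices_def by blast
  qed
qed

end

theorem theorem4p3:
  fixes P :: "'p set" and L :: "'p set set" and n k l m :: nat
    and f :: "int set \<Rightarrow> 'p set"
  assumes "polar_space P L n" and "n \<ge> 3"
    and "0 < m" and "m \<le> k" and "l \<le> n"
    and "int l - int m = int n - int k" and "int n - int k > 1" and "int m \<le> int l - 3"
    and "graph_embedding (PJ_vertices l m) (PJ_adj l m)
           (Grass P L (int k)) (Grass_adj P L (int k)) f"
    and "\<And>T. T \<in> PJ_tops l m \<Longrightarrow>
           pls_independent (Grass P L (int k)) (Grass_lines P L (int k)) (f ` T) \<and>
           (\<exists>U\<in>Grass_tops P L (int k). f ` T \<subseteq> U)"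
  shows "\<exists>N\<in>Grass P L (int k - int m - 1).
           parabolic_apartment P L n k m N (f ` PJ_vertices l m)"
proof -
  have "johnson_embedding P L n k l m f"
    unfolding johnson_embedding_def johnson_embedding_axioms_def
    using assms(1-6,8-10) by simp
  then interpret johnson_embedding P L n k l m f .
  show ?thesis using vertex_Grass image_is_apartment by blast
qed

end
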